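(* Let $K$ be a field, $n\le r$ integers, $p\ge 3$, and let $(A_1,\ldots,A_p)$ be a tuple of matrices in $M_n(K)$ such that for every $l$ with $2\le l\le p$ there is some $m\in\{1,\ldots,p\}\setminus\{1,l\}$ for which hypothesis $(H_{1lm})$ holds. If $(A_1,\ldots,A_p)$ has a commuting extension of size $r$, it is essentially unique. Moreover, if a commuting extension of size $r$ of $(A_1,\ldots,A_p)$ exists with entries in the algebraic closure $\overline{K}$, then one exists with entries in $K$.
   Context: $M_{a,b}(K)$ denotes $a\times b$ matrices over $K$, $M_a(K)=M_{a,a}(K)$, $GL_a(K)$ invertible matrices, $I_a$ identity; $[A,B]=AB-BA$; $\operatorname{Im} A$ is the column space. A tuple $(Z_1,\ldots,Z_p)$ in $M_r(K)$ is a commuting extension of size $r$ of $(A_1,\ldots,A_p)$ in $M_n(K)$ if the $Z_i$ pairwise commute and $Z_i=\begin{pmatrix} A_i & B_i\\ C_i & D_i\end{pmatrix}$ with $B_i\in M_{n,r-n}(K)$, $C_i\in M_{r-n,n}(K)$, $D_i\in M_{r-n}(K)$. For $M\in GL_{r-n}(K)$, $\rho_M(Z)=\begin{pmatrix} I_n&0\\0&M\end{pmatrix}^{-1} Z \begin{pmatrix} I_n&0\\0&M\end{pmatrix}$. Essential uniqueness means any two commuting extensions $(Z_i),(Z'_i)$ of size $r$ satisfy $Z'_i=\rho_M(Z_i)$ for all $i$ for a single $M\in GL_{r-n}(K)$. For distinct indices $k,l,m$, hypothesis $(H_{klm})$ means: (i) $\operatorname{Im}[A_k,A_l]$, $\operatorname{Im}[A_k,A_m]$,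 $\operatorname{Im}[A_l,A_m]$ all have dimension $2(r-n)$; and (ii) $\operatorname{Im}[A_k,A_l]+\operatorname{Im}[A_k,A_m]$, $\operatorname{Im}[A_l,A_k]+\operatorname{Im}[A_l,A_m]$, $\operatorname{Im}[A_m,A_k]+\operatorname{Im}[A_m,A_l]$ all have dimension $3(r-n)$. *)

theory Defs
  imports "Jordan_Normal_Form.DL_Rank" "HOL-Algebra.Algebraic_Closure_Type"
begin

definition commutator :: "'a::ring mat \<Rightarrow> 'a mat \<Rightarrow> 'a mat" where
  "commutator A B = A * B - B * A"

text \<open>The subspaces are those of \<open>K\<^sup>n\<close>, with \<open>K\<close> the type \<^typ>\<open>'a\<close>.\<close>

definition subspace_plus :: "nat \<Rightarrow> 'a::field vec set \<Rightarrow> 'a vec set \<Rightarrow> 'a vec set" where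
  "subspace_plus n U W = LinearCombinations.module.submodule_sum (module_vec TYPE('a) n) U W"

definition subspace_dim :: "nat \<Rightarrow> 'a::field vec set \<Rightarrow> nat" where
  "subspace_dim n W = vectorspace.dim class_ring ((module_vec TYPE('a) n)\<lparr>carrier := W\<rparr>)"

definition hypothesis_H ::
  "nat \<Rightarrow> nat \<Rightarrow> (nat \<Rightarrow> 'a::field mat) \<Rightarrow> nat \<Rightarrow> nat \<Rightarrow> nat \<Rightarrow> bool" where
  "hypothesis_H n r A k l m \<longleftrightarrow>
     (let Im = (\<lambda>i j. vec_space.col_space n (commutator (A i) (A j))) in
       subspace_dim n (Im k l) = 2 * (r - n) \<and>
       subspace_dim n (Im k m) = 2 * (r - n) \<and>
       subspace_dim n (Im l m) = 2 * (r - n) \<and>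
       subspace_dim n (subspace_plus n (Im k l) (Im k m)) = 3 * (r - n) \<and>
       subspace_dim n (subspace_plus n (Im l k) (Im l m)) = 3 * (r - n) \<and>
       subspace_dim n (subspace_plus n (Im m k) (Im m l)) = 3 * (r - n))"

text \<open>A tuple of length \<open>p\<close> is a function of which only the values on \<open>{1..p}\<close> matter.\<close>

definition commuting_extension ::
  "nat \<Rightarrow> nat \<Rightarrow> nat \<Rightarrow> (nat \<Rightarrow> 'a::field mat) \<Rightarrow> (nat \<Rightarrow> 'a mat) \<Rightarrow> bool" where
  "commuting_extension n r p A Z \<longleftrightarrow>
     (\<forall>i\<in>{1..p}. Z i \<in> carrier_mat r r) \<and>
     (\<forall>i\<in>{1..p}. \<forall>j\<in>{1..p}. Z i * Z j = Z j * Z i) \<and>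
     (\<forall>i\<in>{1..p}. \<exists>B\<in>carrier_mat n (r - n). \<exists>C\<in>carrier_mat (r - n) n.
        \<exists>D\<in>carrier_mat (r - n) (r - n). Z i = four_block_mat (A i) B C D)"

definition GL :: "nat \<Rightarrow> 'a::field mat set" where
  "GL k = Units (ring_mat TYPE('a) k ())"

definition rho :: "nat \<Rightarrow> nat \<Rightarrow> 'a::field mat \<Rightarrow> 'a mat \<Rightarrow> 'a mat" where
  "rho n r M Z =
     (let G = four_block_mat (1\<^sub>m n) (0\<^sub>m n (r - n)) (0\<^sub>m (r - n) n) M
      in inv\<^bsub>ring_mat TYPE('a) r ()\<^esub> G * Z * G)"

definition essentially_unique_extension ::
  "nat \<Rightarrow> nat \<Rightarrow> nat \<Rightarrow> (nat \<Rightarrow> 'a::field mat) \<Rightarrow> bool" where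
  "essentially_unique_extension n r p A \<longleftrightarrow>
     (\<forall>Z Z'. commuting_extension n r p A Z \<longrightarrow> commuting_extension n r p A Z' \<longrightarrow>
        (\<exists>M\<in>GL (r - n). \<forall>i\<in>{1..p}. Z' i = rho n r M (Z i)))"

end

theory Submission
  imports Defs "Jordan_Normal_Form.Gauss_Jordan_Elimination"
begin

text \<open>
  Put \<open>q = r - n\<close>. Commutation of the extensions gives \<open>[A\<^sub>i, A\<^sub>j] = B\<^sub>j C\<^sub>i - B\<^sub>i C\<^sub>j\<close>, so the rank
  conditions \<open>(H\<^sub>k\<^sub>l\<^sub>m)\<close> say that \<open>(B\<^sub>k | B\<^sub>l | B\<^sub>m)\<close> has a left inverse and each pair of the \<open>C\<^sub>i\<close>,
  stacked, has a right inverse. Hence the column space of \<open>B\<^sub>k\<close> is the intersection of the images of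
  \<open>[A\<^sub>k, A\<^sub>l]\<close> and \<open>[A\<^sub>k, A\<^sub>m]\<close>, and is determined by the \<open>A\<^sub>i\<close>. For two extensions this gives
  \<open>B'\<^sub>i = B\<^sub>i M\<^sub>i\<close>; comparing the commutators yields \<open>C\<^sub>i = M\<^sub>j C'\<^sub>i\<close> for \<open>i \<noteq> j\<close>, so all \<open>M\<^sub>i\<close> are equal,
  and the \<open>D\<^sub>i\<close> are read off \<open>A\<^sub>i B\<^sub>j - A\<^sub>j B\<^sub>i = B\<^sub>j D\<^sub>i - B\<^sub>i D\<^sub>j\<close>.

  For the descent, the algebraic closure is replaced by an arbitrary extension field \<open>L\<close>, and \<open>p\<close> is a
  \<open>K\<close>-linear projection of \<open>L\<close> onto \<open>K\<close>. Applied entrywise it commutes with multiplication by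
  matrices over \<open>K\<close>, so a matrix uniquely determined by linear equations over \<open>K\<close> is fixed by \<open>p\<close>.
  After a conjugation \<open>B\<^sub>1\<close> has entries in \<open>K\<close>, and the equations above then show this for
  all the blocks.
\<close>

subsection \<open>Matrix algebra with side conditions on dimensions\<close>

lemma mat_assoc:
  "dim_col A = dim_row B \<Longrightarrow> dim_col B = dim_row C \<Longrightarrow> A * B * C = A * (B * (C :: 'a :: semiring_0 mat))"
  by (rule assoc_mult_mat[of _ "dim_row A" "dim_row B" _ "dim_row C" _ "dim_col C"]) auto

lemma mat_add_mult:
  "dim_row A = dim_row B \<Longrightarrow> dim_col A = dim_col B \<Longrightarrow> dim_col B = dim_row C \<Longrightarrow>
    (A + B) * C = A * C + B * (C :: 'a :: semiring_0 mat)"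
  by (rule add_mult_distrib_mat[of _ "dim_row A" "dim_row C" _ _ "dim_col C"]) auto

lemma mat_mult_add:
  "dim_row B = dim_row C \<Longrightarrow> dim_col B = dim_col C \<Longrightarrow> dim_col A = dim_row C \<Longrightarrow>
    A * (B + C) = A * B + A * (C :: 'a :: semiring_0 mat)"
  by (rule mult_add_distrib_mat[of _ "dim_row A" "dim_row C" _ "dim_col C"]) auto

lemma mat_minus_mult:
  "dim_row A = dim_row B \<Longrightarrow> dim_col A = dim_col B \<Longrightarrow> dim_col B = dim_row C \<Longrightarrow>
    (A - B) * C = A * C - B * (C :: 'a :: ring mat)"
  by (rule minus_mult_distrib_mat[of _ "dim_row A" "dim_row C" _ _ "dim_col C"]) auto

lemma mat_mult_minus:
  "dim_row B = dim_row C \<Longrightarrow> dim_col B = dim_col C \<Longrightarrow> dim_col A = dim_row C \<Longrightarrow>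
    A * (B - C) = A * B - A * (C :: 'a :: ring mat)"
  by (rule mult_minus_distrib_mat[of _ "dim_row A" "dim_row C" _ "dim_col C"]) auto

lemma mat_diff_zero: "dim_row A = nr \<Longrightarrow> dim_col A = nc \<Longrightarrow> A - 0\<^sub>m nr nc = (A :: 'a :: group_add mat)"
  by (intro eq_matI) auto

lemma mat_zero_diff: "dim_row A = nr \<Longrightarrow> dim_col A = nc \<Longrightarrow> 0\<^sub>m nr nc - A = - (A :: 'a :: group_add mat)"
  by (intro eq_matI) auto

lemma mat_add_uminus:
  "dim_row A = dim_row B \<Longrightarrow> dim_col A = dim_col B \<Longrightarrow> A + - B = A - (B :: 'a :: group_add mat)"
  by (intro eq_matI) auto

text \<open>Used for rewriting, these rules expand products over sums and nest them to the right. An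
  inverse pair \<open>R * B\<close> therefore has to be available in the form
  \<open>R * (B * W) = W\<close>, which is why such auxiliary facts recur below.\<close>

lemmas mat_algebra = mat_assoc mat_add_mult mat_mult_add mat_minus_mult mat_mult_minus
  mat_diff_zero mat_zero_diff mat_add_uminus

subsection \<open>Dimensions of column spaces as matrix identities\<close>

text \<open>Gauss-Jordan elimination on the transpose of \<open>B\<close> is a column operation
  \<open>M\<close> on \<open>B\<close>. Injectivity puts a pivot in every row, and \<open>S\<close>
  selects the \<open>q\<close> pivot positions. The entries of \<open>S\<close> are recorded as 0 or
  1 because such a matrix lies over every subfield.\<close>

lemma injective_imp_invertible_minor:
  fixes B :: "'a :: field mat"
  assumes B: "B \<in> carrier_mat n q"
    and inj: "\<And>v. v \<in> carrier_vec q \<Longrightarrow> B *\<^sub>v v = 0\<^sub>v n \<Longrightarrow> v = 0\<^sub>v q"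
  shows "\<exists>S\<in>carrier_mat q n. \<exists>M\<in>carrier_mat q q.
    (\<forall>i<q. \<forall>j<n. S $$ (i, j) \<in> {0, 1}) \<and> S * (B * M) = 1\<^sub>m q"
proof -
  let ?A = "transpose_mat B"
  have A: "?A \<in> carrier_mat q n" using B by auto
  \<comment> \<open>The second argument has no columns: only the transformation \<open>P\<close> of
    the first one is of interest.\<close>
  obtain C D where CD: "gauss_jordan ?A (0\<^sub>m q 0) = (C, D)" by fastforce
  from gauss_jordan_transform[OF A _ CD, of 0 undefined]
  obtain P where PU: "P \<in> Units (ring_mat TYPE('a) q undefined)" and CP: "C = P * ?A" by auto
  from PU obtain Q where P: "P \<in> carrier_mat q q" and Q: "Q \<in> carrier_mat q q"
    and PQ: "P * Q = 1\<^sub>m q" unfolding Units_def ring_mat_def by auto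
  have C: "C \<in> carrier_mat q n" using CP P A by auto
  from gauss_jordan_row_echelon[OF A CD] obtain f where "pivot_fun C f (dim_col C)"
    unfolding row_echelon_form_def by auto
  then have piv: "pivot_fun C f n" using C by auto
  have dC: "dim_row C = q" using C by auto
  note piv = pivot_funD[OF dC piv]
  let ?M = "transpose_mat P"
  have M: "?M \<in> carrier_mat q q" using P by auto
  have BM: "B * ?M = transpose_mat C"
    unfolding CP using P B by (simp add: transpose_mult[OF P A])
  \<comment> \<open>A row without pivot would be zero, so \<open>B * ?M\<close> would kill the
    \<open>i\<close>-th unit vector, against the injectivity of \<open>B\<close> and the
    invertibility of \<open>?M\<close>.\<close>
  have f: "f i < n" if i: "i < q" for i
  proof (rule ccontr)
    assume "\<not> f i < n"
    with piv(1)[OF i] have fi: "f i = n" by auto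
    have v: "?M *\<^sub>v unit_vec q i \<in> carrier_vec q" using M by auto
    have "B *\<^sub>v (?M *\<^sub>v unit_vec q i) = (B * ?M) *\<^sub>v unit_vec q i"
      using B M by (simp add: assoc_mult_mat_vec[OF B M])
    also have "\<dots> = col (transpose_mat C) i"
      unfolding BM using C i by (intro eq_vecI) auto
    also have "\<dots> = 0\<^sub>v n" using C i piv(2)[OF i, unfolded fi] by (intro eq_vecI) auto
    finally have "?M *\<^sub>v unit_vec q i = 0\<^sub>v q" using inj[OF v] by auto
    then have "transpose_mat Q *\<^sub>v (?M *\<^sub>v unit_vec q i) = 0\<^sub>v q" using Q by auto
    moreover have "transpose_mat Q *\<^sub>v (?M *\<^sub>v unit_vec q i) = (transpose_mat Q * ?M) *\<^sub>v unit_vec q i"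
      using Q M by (simp add: assoc_mult_mat_vec[of _ q q _ q])
    moreover have "transpose_mat Q * ?M = 1\<^sub>m q"
      using transpose_mult[OF P Q] PQ by simp
    ultimately have "unit_vec q i = (0\<^sub>v q :: 'a vec)" by simp
    then have "unit_vec q i $ i = (0\<^sub>v q :: 'a vec) $ i" by simp
    then show False using i by simp
  qed
  \<comment> \<open>Row \<open>i\<close> of \<open>S\<close> selects position \<open>f i\<close>;
    the pivot columns of \<open>C\<close> are unit vectors.\<close>
  define S :: "'a mat" where "S = mat q n (\<lambda>(i, j). if j = f i then 1 else 0)"
  have S: "S \<in> carrier_mat q n" unfolding S_def by auto
  have "S * (B * ?M) = 1\<^sub>m q"
  proof (intro eq_matI)
    fix i j assume "i < dim_row (1\<^sub>m q :: 'a mat)" "j < dim_col (1\<^sub>m q :: 'a mat)"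
    then have i: "i < q" and j: "j < q" by auto
    have "(S * (B * ?M)) $$ (i, j) = (\<Sum>k = 0..<n. S $$ (i, k) * C $$ (j, k))"
      unfolding BM using S C i j by (auto simp: scalar_prod_def)
    also have "\<dots> = (\<Sum>k = 0..<n. if k = f i then C $$ (j, k) else 0)"
      using i by (intro sum.cong) (auto simp: S_def)
    also have "\<dots> = C $$ (j, f i)" using f[OF i] by simp
    also have "\<dots> = 1\<^sub>m q $$ (i, j)" using piv(4,5)[OF i f[OF i]] i j by auto
    finally show "(S * (B * ?M)) $$ (i, j) = 1\<^sub>m q $$ (i, j)" .
  qed (use S B M in auto)
  then show ?thesis using S M by (intro bexI[of _ S] bexI[of _ ?M]) (auto simp: S_def)
qed

lemma left_inverse_imp_invertible_minor:
  fixes B :: "'a :: field mat"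
  assumes B: "B \<in> carrier_mat n q" and R: "R \<in> carrier_mat q n" and RB: "R * B = 1\<^sub>m q"
  shows "\<exists>S\<in>carrier_mat q n. \<exists>M\<in>carrier_mat q q.
    (\<forall>i<q. \<forall>j<n. S $$ (i, j) \<in> {0, 1}) \<and> S * (B * M) = 1\<^sub>m q"
proof (rule injective_imp_invertible_minor[OF B])
  fix v assume v: "v \<in> carrier_vec q" and "B *\<^sub>v v = 0\<^sub>v n"
  then have "R *\<^sub>v (B *\<^sub>v v) = 0\<^sub>v q" using R by auto
  then show "v = 0\<^sub>v q" using assoc_mult_mat_vec[OF R B v] RB v by simp
qed

section \<open>Bases of subspaces as columns of left invertible matrices\<close>

context vec_space
begin

text \<open>A basis of \<open>W\<close>, written as the columns of \<open>E\<close>, is an injective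
  matrix, and the invertible minor found above provides the left inverse \<open>L\<close>.\<close>

lemma subspace_basis_matrix:
  assumes W: "VectorSpace.subspace class_ring W V" and fin: "vectorspace.fin_dim class_ring (vs W)"
    and dim: "vectorspace.dim class_ring (vs W) = s"
  shows "\<exists>E\<in>carrier_mat n s. \<exists>L\<in>carrier_mat s n. L * E = 1\<^sub>m s \<and> (\<forall>j<s. col E j \<in> W)"
proof -
  interpret W: vectorspace class_ring "vs W" by (rule subspace_is_vs[OF W])
  have sub: "submodule class_ring W V" using W unfolding VectorSpace.subspace_def by auto
  have WV: "W \<subseteq> carrier_vec n" using sub unfolding submodule_def by auto
  obtain b where finb: "finite b" and b: "W.basis b" using W.finite_basis_exists[OF fin] by auto
  have bW: "b \<subseteq> W" and li': "W.lin_indpt b" using b unfolding W.basis_def by auto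
  have li: "lin_indpt b" using span_li_not_depend(2)[OF bW sub] li' by auto
  have card: "card b = s" using W.dim_basis[OF finb b] dim by auto
  obtain xs where xs: "set xs = b" "distinct xs" using finite_distinct_list[OF finb] by auto
  then have len: "length xs = s" using card distinct_card by fastforce
  define E where "E = mat_of_cols n xs"
  have E: "E \<in> carrier_mat n s" unfolding E_def len[symmetric] by auto
  have xsn: "set xs \<subseteq> carrier_vec n" using xs bW WV by auto
  have colsE: "cols E = xs" unfolding E_def using xsn by (simp add: cols_mat_of_cols)
  have "v = 0\<^sub>v s" if "v \<in> carrier_vec s" "E *\<^sub>v v = 0\<^sub>v n" for v
    using lin_depI[OF E that(1) _ that(2)] colsE xs li by auto
  from injective_imp_invertible_minor[OF E this] obtain S M where
    S: "S \<in> carrier_mat s n" and M: "M \<in> carrier_mat s s" and SEM: "S * (E * M) = 1\<^sub>m s" by auto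
  have "(S * E) * M = 1\<^sub>m s" using SEM S E M by (simp add: mat_algebra)
  \<comment> \<open>The inverse \<open>M\<close> of the square matrix \<open>S * E\<close> is
    two-sided, so \<open>M * S\<close> is a left inverse of \<open>E\<close>.\<close>
  from mat_mult_left_right_inverse[OF _ M this] have "(M * S) * E = 1\<^sub>m s"
    using S E M by (simp add: mat_algebra)
  moreover have "col E j \<in> W" if "j < s" for j
  proof -
    have "col E j = xs ! j" using that E colsE cols_nth[of j E] by simp
    then show ?thesis using nth_mem[of j xs] that len xs(1) bW by auto
  qed
  moreover have "M * S \<in> carrier_mat s n" using M S by simp
  ultimately show ?thesis using E by blast
qed

lemma col_space_subspace:
  assumes "P \<in> carrier_mat n nc"
  shows "VectorSpace.subspace class_ring (col_space P) V" "vectorspace.fin_dim class_ring (vs (col_space P))"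
proof -
  have "set (cols P) \<subseteq> carrier_vec n" using cols_dim[of P] assms by simp
  then show "VectorSpace.subspace class_ring (col_space P) V"
    unfolding col_space_def by (rule span_is_subspace)
  show "vectorspace.fin_dim class_ring (vs (col_space P))"
    unfolding col_space_def by (rule fin_dim_span_cols[OF assms])
qed

lemma cols_in_col_space_imp_factor:
  assumes P: "P \<in> carrier_mat n nc" and E: "\<And>j. j < s \<Longrightarrow> e j \<in> col_space P"
  shows "\<exists>G\<in>carrier_mat nc s. \<forall>j<s. col (P * G) j = e j"
proof -
  have "\<forall>j. \<exists>x. j < s \<longrightarrow> x \<in> carrier_vec nc \<and> P *\<^sub>v x = e j"
    using E col_space_eq[OF P] P by auto
  then obtain x where x: "\<And>j. j < s \<Longrightarrow> x j \<in> carrier_vec nc" "\<And>j. j < s \<Longrightarrow> P *\<^sub>v x j = e j"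
    by metis
  let ?G = "mat_of_cols nc (map x [0..<s])"
  have G: "?G \<in> carrier_mat nc s" using mat_of_cols_carrier(1)[of nc "map x [0..<s]"] by simp
  have "col (P * ?G) j = e j" if "j < s" for j
  proof -
    have "col ?G j = x j" using that x(1) by (simp add: col_mat_of_cols)
    then show ?thesis using col_mult2[OF P G that] x(2)[OF that] by simp
  qed
  then show ?thesis using G by blast
qed

text \<open>Writing a basis of the column space as \<open>P * G\<close> puts the dimension into an
  identity that mentions no vector space and is preserved by field homomorphisms.\<close>

lemma dim_col_space_witness:
  assumes P: "P \<in> carrier_mat n nc" and dim: "subspace_dim n (col_space P) = s"
  shows "\<exists>L\<in>carrier_mat s n. \<exists>G\<in>carrier_mat nc s. L * (P * G) = 1\<^sub>m s"
proof -
  from subspace_basis_matrix[OF col_space_subspace[OF P] dim[unfolded subspace_dim_def]]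
  obtain E L where E: "E \<in> carrier_mat n s" and L: "L \<in> carrier_mat s n" and LE: "L * E = 1\<^sub>m s"
    and cols: "\<forall>j<s. col E j \<in> col_space P"
    by (elim bexE conjE)
  obtain G where G: "G \<in> carrier_mat nc s" and PG: "\<forall>j<s. col (P * G) j = col E j"
    using cols_in_col_space_imp_factor[OF P, of s "col E"] cols by auto
  have "P * G = E" using PG P G E by (intro mat_col_eqI) auto
  then show ?thesis using L G LE by auto
qed

text \<open>Each basis vector of the sum splits into a part from either column space; the
  coefficients of these parts are the columns of \<open>G\<close> and \<open>Y\<close>.\<close>

lemma dim_sum_col_space_witness:
  assumes P: "P \<in> carrier_mat n nc" and Q: "Q \<in> carrier_mat n nd"
    and dim: "subspace_dim n (subspace_plus n (col_space P) (col_space Q)) = s"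
  shows "\<exists>L\<in>carrier_mat s n. \<exists>G\<in>carrier_mat nc s. \<exists>Y\<in>carrier_mat nd s.
    L * (P * G + Q * Y) = 1\<^sub>m s"
proof -
  note PQ = col_space_subspace[OF P] col_space_subspace[OF Q]
  from subspace_basis_matrix[OF sum_is_subspace[OF PQ(1,3)] fin_dim_subspace_sum[OF PQ(1,3,2,4)]
      dim[unfolded subspace_dim_def subspace_plus_def]]
  obtain E L where E: "E \<in> carrier_mat n s" and L: "L \<in> carrier_mat s n" and LE: "L * E = 1\<^sub>m s"
    and cols: "\<forall>j<s. col E j \<in> subspace_sum (col_space P) (col_space Q)"
    by (elim bexE conjE)
  have "\<exists>u v. j < s \<longrightarrow> u \<in> col_space P \<and> v \<in> col_space Q \<and> col E j = u + v" for j
    using cols unfolding submodule_sum_def image_def by fastforce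
  then obtain u v where uv: "\<And>j. j < s \<Longrightarrow> u j \<in> col_space P" "\<And>j. j < s \<Longrightarrow> v j \<in> col_space Q"
    "\<And>j. j < s \<Longrightarrow> col E j = u j + v j" by metis
  obtain G where G: "G \<in> carrier_mat nc s" and PG: "\<forall>j<s. col (P * G) j = u j"
    using cols_in_col_space_imp_factor[OF P, of s u] uv by auto
  obtain Y where Y: "Y \<in> carrier_mat nd s" and QY: "\<forall>j<s. col (Q * Y) j = v j"
    using cols_in_col_space_imp_factor[OF Q, of s v] uv by auto
  have PGc: "P * G \<in> carrier_mat n s" and QYc: "Q * Y \<in> carrier_mat n s" using P Q G Y by auto
  have "P * G + Q * Y = E"
  proof (intro mat_col_eqI)
    fix j assume "j < dim_col E"
    then have j: "j < s" using E by auto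
    show "col (P * G + Q * Y) j = col E j"
      using col_add[OF PGc QYc j] PGc QYc PG QY uv j by auto
  qed (use P Q G Y E in auto)
  then show ?thesis using L G Y LE by auto
qed

end

text \<open>For \<open>a < c\<close> this is the \<open>a\<close>-th of the \<open>c\<close> block
  columns of width \<open>q\<close> of the identity matrix. It moves a single block into or out of a
  block matrix, so that block rows and block columns can be written as sums of products.\<close>

definition selection_mat :: "nat \<Rightarrow> nat \<Rightarrow> nat \<Rightarrow> 'a :: field mat" where
  "selection_mat c q a = mat (c * q) q (\<lambda>(i, j). if i = a * q + j then 1 else 0)"

lemma selection_mat_dim [simp]:
  "dim_row (selection_mat c q a) = c * q" "dim_col (selection_mat c q a) = q"
  unfolding selection_mat_def by auto

text \<open>By division with remainder, the position \<open>a * q + i\<close> with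
  \<open>i < q\<close> determines both the block \<open>a\<close> and the offset
  \<open>i\<close>.\<close>

lemma selection_mat_orthogonal:
  assumes "a < c" "b < c"
  shows "transpose_mat (selection_mat c q a) * selection_mat c q b =
    (if a = b then 1\<^sub>m q else 0\<^sub>m q q :: 'a :: field mat)"
proof -
  have eq: "a * q + i = b * q + j \<longleftrightarrow> a = b \<and> i = j" if "i < q" "j < q" for i j
    using that by (metis add_left_cancel div_mult_self3 div_less Nat.add_0_right not_less_zero)
  have bound: "a * q + i < c * q" if "i < q" for i
  proof -
    have "a * q + i < Suc a * q" using that by simp
    also have "\<dots> \<le> c * q" using assms(1) by (intro mult_le_mono1) simp
    finally show ?thesis .
  qed
  show ?thesis
  proof (intro eq_matI)
    fix i j
    assume "i < dim_row (if a = b then 1\<^sub>m q else 0\<^sub>m q q :: 'a mat)"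
      and "j < dim_col (if a = b then 1\<^sub>m q else 0\<^sub>m q q :: 'a mat)"
    then have i: "i < q" and j: "j < q" by (auto split: if_splits)
    let ?T = "\<lambda>a. selection_mat c q a :: 'a mat"
    have "(transpose_mat (?T a) * ?T b) $$ (i, j) = (\<Sum>k = 0..<c * q. ?T a $$ (k, i) * ?T b $$ (k, j))"
      using i j by (auto simp: scalar_prod_def)
    also have "\<dots> = (\<Sum>k = 0..<c * q. if k = a * q + i then (if a = b \<and> i = j then 1 else 0) else 0)"
      using i j eq by (intro sum.cong) (auto simp: selection_mat_def)
    also have "\<dots> = (if a = b \<and> i = j then 1 else 0)" using bound[OF i] by simp
    finally show "(transpose_mat (?T a) * ?T b) $$ (i, j) =
        (if a = b then 1\<^sub>m q else 0\<^sub>m q q) $$ (i, j)" using i j by auto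
  qed auto
qed

text \<open>With \<open>F = (B0 | B1 | B2)\<close> and \<open>H\<close> the stack of
  \<open>G0\<close>, \<open>G1\<close>, \<open>G2\<close>, the square matrices \<open>L * F\<close>
  and \<open>H\<close> are inverse to each other on both sides. So \<open>H * L\<close> is a left
  inverse of \<open>F\<close>, and its three block rows are the witnesses.\<close>

lemma left_inverses_of_three_blocks:
  fixes B0 :: "'a :: field mat"
  assumes B: "B0 \<in> carrier_mat n q" "B1 \<in> carrier_mat n q" "B2 \<in> carrier_mat n q"
    and G: "G0 \<in> carrier_mat q (3 * q)" "G1 \<in> carrier_mat q (3 * q)" "G2 \<in> carrier_mat q (3 * q)"
    and L: "L \<in> carrier_mat (3 * q) n" and inv: "L * (B0 * G0 + B1 * G1 + B2 * G2) = 1\<^sub>m (3 * q)"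
  shows "\<exists>R0\<in>carrier_mat q n. \<exists>R1\<in>carrier_mat q n. \<exists>R2\<in>carrier_mat q n.
    R0 * B0 = 1\<^sub>m q \<and> R0 * B1 = 0\<^sub>m q q \<and> R0 * B2 = 0\<^sub>m q q \<and>
    R1 * B0 = 0\<^sub>m q q \<and> R1 * B1 = 1\<^sub>m q \<and> R1 * B2 = 0\<^sub>m q q \<and>
    R2 * B0 = 0\<^sub>m q q \<and> R2 * B1 = 0\<^sub>m q q \<and> R2 * B2 = 1\<^sub>m q"
proof -
  define T :: "nat \<Rightarrow> 'a mat" where "T = selection_mat 3 q"
  define T' where "T' a = transpose_mat (T a)" for a
  have dT [simp]: "dim_row (T a) = 3 * q" "dim_col (T a) = q" "dim_row (T' a) = q" "dim_col (T' a) = 3 * q"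
    for a by (simp_all add: T_def T'_def)
  have TT: "T' a * T b = (if a = b then 1\<^sub>m q else 0\<^sub>m q q)" if "a < 3" "b < 3" for a b
    unfolding T_def T'_def by (rule selection_mat_orthogonal[OF that])
  have TTG: "T' a * (T b * U) = (if a = b then U else 0\<^sub>m q (dim_col U))"
    if "a < 3" "b < 3" "dim_row U = q" for a b U
    using that by (simp add: mat_assoc[symmetric] TT)
  define F where "F = B0 * T' 0 + B1 * T' 1 + B2 * T' 2"
  define H where "H = T 0 * G0 + T 1 * G1 + T 2 * G2"
  have dF: "dim_row F = n" "dim_col F = 3 * q" and dH: "dim_row H = 3 * q" "dim_col H = 3 * q"
    using B G by (simp_all add: F_def H_def)
  have "F * H = B0 * G0 + B1 * G1 + B2 * G2"
    unfolding F_def H_def using B G by (simp add: mat_algebra TTG)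
  then have LFH: "(L * F) * H = 1\<^sub>m (3 * q)" using inv L dF dH by (simp add: mat_algebra)
  have "H * (L * F) = 1\<^sub>m (3 * q)"
    using L dF dH by (intro mat_mult_left_right_inverse[OF _ _ LFH]) auto
  then have HLF: "H * (L * (F * U)) = U" if "dim_row U = 3 * q" for U
    using that L dF dH by (simp add: mat_assoc[symmetric])
  have FT: "F * T 0 = B0" "F * T 1 = B1" "F * T 2 = B2"
    unfolding F_def using B by (simp_all add: mat_algebra TT)
  have R: "(T' a * (H * L)) * (F * T b) = (if a = b then 1\<^sub>m q else 0\<^sub>m q q)" if "a < 3" "b < 3" for a b
    using that L dF dH by (simp add: mat_algebra HLF TT)
  have Rc: "T' a * (H * L) \<in> carrier_mat q n" for a using L dH by auto
  show ?thesis
    using Rc R[of 0 0] R[of 0 1] R[of 0 2] R[of 1 0] R[of 1 1] R[of 1 2] R[of 2 0] R[of 2 1] R[of 2 2]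
    unfolding FT by (intro bexI[of _ "T' 0 * (H * L)"] bexI[of _ "T' 1 * (H * L)"] bexI[of _ "T' 2 * (H * L)"]) auto
qed

text \<open>The difference is \<open>F * H\<close> with \<open>F = (B0 | - B1)\<close> and
  \<open>H\<close> the stack of \<open>C0\<close> and \<open>C1\<close>. Since \<open>L * F\<close>
  and \<open>H * E\<close> are inverse square matrices of size \<open>2 * q\<close>, the product
  \<open>E * (L * F)\<close> is a right inverse of \<open>H\<close>; its block columns are
  \<open>Y0\<close> and \<open>Y1\<close>.\<close>

lemma right_inverses_of_two_blocks:
  fixes B0 :: "'a :: field mat"
  assumes B: "B0 \<in> carrier_mat n q" "B1 \<in> carrier_mat n q"
    and C: "C0 \<in> carrier_mat q n" "C1 \<in> carrier_mat q n"
    and L: "L \<in> carrier_mat (2 * q) n" and E: "E \<in> carrier_mat n (2 * q)"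
    and inv: "L * ((B0 * C0 - B1 * C1) * E) = 1\<^sub>m (2 * q)"
  shows "\<exists>Y0\<in>carrier_mat n q. \<exists>Y1\<in>carrier_mat n q.
    C0 * Y0 = 1\<^sub>m q \<and> C0 * Y1 = 0\<^sub>m q q \<and> C1 * Y0 = 0\<^sub>m q q \<and> C1 * Y1 = 1\<^sub>m q"
proof -
  define T :: "nat \<Rightarrow> 'a mat" where "T = selection_mat 2 q"
  define T' where "T' a = transpose_mat (T a)" for a
  have dT [simp]: "dim_row (T a) = 2 * q" "dim_col (T a) = q" "dim_row (T' a) = q" "dim_col (T' a) = 2 * q"
    for a by (simp_all add: T_def T'_def)
  have TT: "T' a * T b = (if a = b then 1\<^sub>m q else 0\<^sub>m q q)" if "a < 2" "b < 2" for a b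
    unfolding T_def T'_def by (rule selection_mat_orthogonal[OF that])
  have TTG: "T' a * (T b * U) = (if a = b then U else 0\<^sub>m q (dim_col U))"
    if "a < 2" "b < 2" "dim_row U = q" for a b U
    using that by (simp add: mat_assoc[symmetric] TT)
  define F where "F = B0 * T' 0 - B1 * T' 1"
  define H where "H = T 0 * C0 + T 1 * C1"
  have dF: "dim_row F = n" "dim_col F = 2 * q" and dH: "dim_row H = 2 * q" "dim_col H = n"
    using B C by (simp_all add: F_def H_def)
  have FH: "F * H = B0 * C0 - B1 * C1"
    unfolding F_def H_def using B C by (simp add: mat_algebra TTG)
  have LFH: "(L * F) * (H * E) = 1\<^sub>m (2 * q)"
    using inv[folded FH] L E dF dH by (simp add: mat_assoc)
  have "(H * E) * (L * F) = 1\<^sub>m (2 * q)"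
    using L E dF dH by (intro mat_mult_left_right_inverse[OF _ _ LFH]) auto
  then have HLF: "H * (E * (L * (F * U))) = U" if "dim_row U = 2 * q" for U
    using that L E dF dH by (simp add: mat_assoc[symmetric])
  have TH: "T' 0 * H = C0" "T' 1 * H = C1"
    unfolding H_def using C by (simp_all add: mat_algebra TTG)
  have Y: "(T' a * H) * (E * (L * (F * T b))) = (if a = b then 1\<^sub>m q else 0\<^sub>m q q)" if "a < 2" "b < 2" for a b
    using that L E dF dH by (simp add: mat_algebra HLF TT)
  have Yc: "E * (L * (F * T b)) \<in> carrier_mat n q" for b using L E dF by auto
  show ?thesis
    using Yc Y[of 0 0] Y[of 0 1] Y[of 1 0] Y[of 1 1] unfolding TH
    by (intro bexI[of _ "E * (L * (F * T 0))"] bexI[of _ "E * (L * (F * T 1))"]) auto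
qed

subsection \<open>Block form of commuting extensions\<close>

text \<open>The four identities are the four blocks of \<open>Z i * Z j = Z j * Z i\<close>;
  \<open>q\<close> stands for \<open>r - n\<close>.\<close>

definition block_extension where
  "block_extension n q S A B C D \<longleftrightarrow>
     (\<forall>i\<in>S. A i \<in> carrier_mat n n \<and> B i \<in> carrier_mat n q \<and> C i \<in> carrier_mat q n \<and> D i \<in> carrier_mat q q) \<and>
     (\<forall>i\<in>S. \<forall>j\<in>S.
        A i * A j + B i * C j = A j * A i + B j * C i \<and>
        A i * B j + B i * D j = A j * B i + B j * D i \<and>
        C i * A j + D i * C j = C j * A i + D j * C i \<and>
        C i * B j + D i * D j = C j * B i + D j * (D i :: 'a :: field mat))"

lemma block_extensionD:
  assumes "block_extension n q S A B C D" "i \<in> S"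
  shows "A i \<in> carrier_mat n n" "B i \<in> carrier_mat n q" "C i \<in> carrier_mat q n" "D i \<in> carrier_mat q q"
  using assms unfolding block_extension_def by auto

lemma mat_diff_eq_diff:
  fixes P :: "'a :: ab_group_add mat"
  assumes "P + Q = P' + Q'" and "P \<in> carrier_mat nr nc" "Q \<in> carrier_mat nr nc"
    "P' \<in> carrier_mat nr nc" "Q' \<in> carrier_mat nr nc"
  shows "P - P' = Q' - Q"
proof (intro eq_matI)
  fix i j assume ij: "i < dim_row (Q' - Q)" "j < dim_col (Q' - Q)"
  have "(P + Q) $$ (i, j) = (P' + Q') $$ (i, j)" using assms(1) by simp
  then show "(P - P') $$ (i, j) = (Q' - Q) $$ (i, j)"
    using ij assms(2-5) by (simp add: algebra_simps)
qed (use assms in auto)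

text \<open>These are the upper left and the upper right block of the commutation relation. Both
  have the shape \<open>B j * U - B i * V\<close>, which determines \<open>U\<close> and
  \<open>V\<close> once \<open>(B j | B i)\<close> has a left inverse.\<close>

lemma block_extension_commutator:
  assumes ext: "block_extension n q S A B C D" and i: "i \<in> S" and j: "j \<in> S"
  shows "commutator (A i) (A j) = B j * C i - B i * C j"
    and "A i * B j - A j * B i = B j * D i - B i * D j"
proof -
  note c = block_extensionD[OF ext i] block_extensionD[OF ext j]
  have e: "A i * A j + B i * C j = A j * A i + B j * C i" "A i * B j + B i * D j = A j * B i + B j * D i"
    using ext i j unfolding block_extension_def by auto
  show "commutator (A i) (A j) = B j * C i - B i * C j"
    unfolding commutator_def using c by (intro mat_diff_eq_diff[OF e(1), of n n]) auto
  show "A i * B j - A j * B i = B j * D i - B i * D j"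
    using c by (intro mat_diff_eq_diff[OF e(2), of n q]) auto
qed

text \<open>The rank conditions of the hypothesis \<open>(H\<^sub>k\<^sub>l\<^sub>m)\<close>, stated by matrix identities so that they survive
  an extension of the base field.\<close>

definition full_rank_triple where
  "full_rank_triple n q A k l m \<longleftrightarrow>
     (\<forall>(i, j)\<in>{(k, l), (k, m), (l, m)}. \<exists>L\<in>carrier_mat (2 * q) n. \<exists>E\<in>carrier_mat n (2 * q).
        L * (commutator (A i) (A j) * E) = 1\<^sub>m (2 * q)) \<and>
     (\<exists>L\<in>carrier_mat (3 * q) n. \<exists>E\<in>carrier_mat n (3 * q). \<exists>E'\<in>carrier_mat n (3 * q).
        L * (commutator (A k) (A l) * E + commutator (A k) (A m) * E') = (1\<^sub>m (3 * q) :: 'a :: field mat))"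

lemma hypothesis_H_imp_full_rank_triple:
  fixes A :: "nat \<Rightarrow> 'a :: field mat"
  assumes H: "hypothesis_H n r A k l m"
    and A: "A k \<in> carrier_mat n n" "A l \<in> carrier_mat n n" "A m \<in> carrier_mat n n"
  shows "full_rank_triple n (r - n) A k l m"
proof -
  interpret vec_space "TYPE('a)" n .
  have c: "commutator (A k) (A l) \<in> carrier_mat n n" "commutator (A k) (A m) \<in> carrier_mat n n"
    "commutator (A l) (A m) \<in> carrier_mat n n"
    using A unfolding commutator_def by auto
  show ?thesis
    unfolding full_rank_triple_def
    using H dim_col_space_witness[OF c(1)] dim_col_space_witness[OF c(2)] dim_col_space_witness[OF c(3)]
      dim_sum_col_space_witness[OF c(1,2)]
    unfolding hypothesis_H_def Let_def by simp
qed

text \<open>The \<open>R a\<close> are the block rows of a left inverse of all the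
  \<open>B a\<close> put side by side; \<open>Y\<close> is one block column of a right inverse of
  \<open>C a\<close> stacked on \<open>C b\<close>.\<close>

definition nondegenerate where
  "nondegenerate n q T B C \<longleftrightarrow>
     (\<exists>R. \<forall>a\<in>T. R a \<in> carrier_mat q n \<and> (\<forall>b\<in>T. R a * B b = (if a = b then 1\<^sub>m q else 0\<^sub>m q q))) \<and>
     (\<forall>a\<in>T. \<forall>b\<in>T. a \<noteq> b \<longrightarrow> (\<exists>Y\<in>carrier_mat n q. C a * Y = 1\<^sub>m q \<and> C b * Y = (0\<^sub>m q q :: 'a :: field mat)))"

text \<open>Each commutator factors through two blocks of width \<open>q\<close>, and the combined
  columns of \<open>[A k, A l]\<close> and \<open>[A k, A m]\<close> factor through
  \<open>(B k | B l | B m)\<close>. The ranks in \<open>full\<close> are thus the largest possible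
  ones, which forces the one-sided inverses.\<close>

lemma full_rank_triple_imp_nondegenerate:
  fixes A :: "'i \<Rightarrow> 'a :: field mat"
  assumes ext: "block_extension n q S A B C D"
    and S: "k \<in> S" "l \<in> S" "m \<in> S" and dist: "k \<noteq> l" "k \<noteq> m" "l \<noteq> m"
    and full: "full_rank_triple n q A k l m"
  shows "nondegenerate n q {k, l, m} B C"
proof -
  note com = block_extension_commutator(1)[OF ext]
  note c = block_extensionD[OF ext S(1)] block_extensionD[OF ext S(2)] block_extensionD[OF ext S(3)]
  have Y: "\<exists>Y\<in>carrier_mat n q. \<exists>Y'\<in>carrier_mat n q.
      C i * Y = 1\<^sub>m q \<and> C i * Y' = 0\<^sub>m q q \<and> C j * Y = 0\<^sub>m q q \<and> C j * Y' = 1\<^sub>m q"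
    if ij: "(i, j) \<in> {(k, l), (k, m), (l, m)}" for i j
  proof -
    have iS: "i \<in> S" and jS: "j \<in> S" using ij S by auto
    obtain L E where L: "L \<in> carrier_mat (2 * q) n" and E: "E \<in> carrier_mat n (2 * q)"
      and inv: "L * ((B j * C i - B i * C j) * E) = 1\<^sub>m (2 * q)"
      using full ij com[OF iS jS] unfolding full_rank_triple_def by fastforce
    note ci = block_extensionD[OF ext iS] block_extensionD[OF ext jS]
    from right_inverses_of_two_blocks[OF ci(6,2) ci(3,7) L E inv] show ?thesis .
  qed
  have Y': "\<forall>a\<in>{k, l, m}. \<forall>b\<in>{k, l, m}. a \<noteq> b \<longrightarrow>
      (\<exists>Y\<in>carrier_mat n q. C a * Y = 1\<^sub>m q \<and> C b * Y = 0\<^sub>m q q)"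
    using Y[of k l] Y[of k m] Y[of l m] dist by blast
  obtain L E E' where L: "L \<in> carrier_mat (3 * q) n" and E: "E \<in> carrier_mat n (3 * q)"
    and E': "E' \<in> carrier_mat n (3 * q)"
    and inv: "L * (commutator (A k) (A l) * E + commutator (A k) (A m) * E') = 1\<^sub>m (3 * q)"
    using full unfolding full_rank_triple_def by blast
  \<comment> \<open>Sorting by left factors exhibits the sum as \<open>(B k | B l | B m)\<close>
    times a stack of three blocks.\<close>
  have eq: "commutator (A k) (A l) * E + commutator (A k) (A m) * E' =
      B k * (- (C l * E) - C m * E') + B l * (C k * E) + B m * (C k * E')"
    (is "_ = ?rhs")
  proof -
    have d: "B l * (C k * E) \<in> carrier_mat n (3 * q)" "B k * (C l * E) \<in> carrier_mat n (3 * q)"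
       "B m * (C k * E') \<in> carrier_mat n (3 * q)" "B k * (C m * E') \<in> carrier_mat n (3 * q)"
      using c E E' by auto
    have "commutator (A k) (A l) * E + commutator (A k) (A m) * E' =
       (B l * (C k * E) - B k * (C l * E)) + (B m * (C k * E') - B k * (C m * E'))"
      using c E E' S by (simp add: com mat_algebra)
    also have "\<dots> = - (B k * (C l * E)) - B k * (C m * E') + B l * (C k * E) + B m * (C k * E')"
      using d by (intro eq_matI) (auto simp: carrier_matD[OF d(1)] carrier_matD[OF d(2)] 
        carrier_matD[OF d(3)] carrier_matD[OF d(4)] simp del: index_mult_mat)
    also have "\<dots> = ?rhs" using c E E' by (simp add: mat_mult_minus)
    finally show ?thesis .
  qed
  have G: "- (C l * E) - C m * E' \<in> carrier_mat q (3 * q)" "C k * E \<in> carrier_mat q (3 * q)"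
    "C k * E' \<in> carrier_mat q (3 * q)" using c E E' by auto
  obtain R0 R1 R2 where R: "R0 \<in> carrier_mat q n" "R1 \<in> carrier_mat q n" "R2 \<in> carrier_mat q n"
     "R0 * B k = 1\<^sub>m q" "R0 * B l = 0\<^sub>m q q" "R0 * B m = 0\<^sub>m q q"
     "R1 * B k = 0\<^sub>m q q" "R1 * B l = 1\<^sub>m q" "R1 * B m = 0\<^sub>m q q"
     "R2 * B k = 0\<^sub>m q q" "R2 * B l = 0\<^sub>m q q" "R2 * B m = 1\<^sub>m q"
    using left_inverses_of_three_blocks[OF c(2,6,10) G L] inv unfolding eq by blast
  have "\<exists>R. \<forall>a\<in>{k, l, m}. R a \<in> carrier_mat q n \<and>
      (\<forall>b\<in>{k, l, m}. R a * B b = (if a = b then 1\<^sub>m q else 0\<^sub>m q q))"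
    using R dist by (intro exI[of _ "\<lambda>a. if a = k then R0 else if a = l then R1 else R2"]) auto
  then show ?thesis using Y' unfolding nondegenerate_def by blast
qed

text \<open>Multiplication by \<open>R0\<close> and \<open>R1\<close> extracts the two coefficients
  of a combination of \<open>B0\<close> and \<open>B1\<close>.\<close>

lemma two_blocks_cancel:
  fixes B0 :: "'a :: field mat"
  assumes B: "B0 \<in> carrier_mat n q" "B1 \<in> carrier_mat n q"
    and R: "R0 \<in> carrier_mat q n" "R1 \<in> carrier_mat q n"
    "R0 * B0 = 1\<^sub>m q" "R0 * B1 = 0\<^sub>m q q" "R1 * B0 = 0\<^sub>m q q" "R1 * B1 = 1\<^sub>m q"
    and U: "U0 \<in> carrier_mat q s" "U1 \<in> carrier_mat q s"
    and V: "V0 \<in> carrier_mat q s" "V1 \<in> carrier_mat q s"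
    and eq: "B0 * U0 - B1 * U1 = B0 * V0 - B1 * V1"
  shows "U0 = V0" "U1 = V1"
proof -
  have RB: "R0 * (B0 * W) = W" "R0 * (B1 * W) = 0\<^sub>m q s" "R1 * (B0 * W) = 0\<^sub>m q s" "R1 * (B1 * W) = W"
    if W: "W \<in> carrier_mat q s" for W
    using R B W by (simp_all add: mat_assoc[symmetric])
  have "R0 * (B0 * U0 - B1 * U1) = U0" "R0 * (B0 * V0 - B1 * V1) = V0"
    using B R U V by (simp_all add: mat_algebra RB)
  then show "U0 = V0" using eq by simp
  have "R1 * (B0 * U0 - B1 * U1) = - U1" "R1 * (B0 * V0 - B1 * V1) = - V1"
    using B R U V by (simp_all add: mat_algebra RB)
  then have "- U1 = - V1" using eq by simp
  then show "U1 = V1" by (metis uminus_uminus_mat)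
qed

subsection \<open>Uniqueness\<close>

lemma nondegenerateE:
  assumes "nondegenerate n q T B C"
  obtains R where "\<And>a. a \<in> T \<Longrightarrow> R a \<in> carrier_mat q n"
    and "\<And>a. a \<in> T \<Longrightarrow> R a * B a = 1\<^sub>m q"
    and "\<And>a b. a \<in> T \<Longrightarrow> b \<in> T \<Longrightarrow> a \<noteq> b \<Longrightarrow> R a * B b = 0\<^sub>m q q"
  using assms unfolding nondegenerate_def by metis

lemma nondegenerate_right_inverse:
  assumes "nondegenerate n q T B C" "a \<in> T" "b \<in> T" "a \<noteq> b"
  obtains Y where "Y \<in> carrier_mat n q" "C a * Y = 1\<^sub>m q" "C b * Y = 0\<^sub>m q q"
  using assms unfolding nondegenerate_def by metis

text \<open>A common column of the two commutators is a combination of \<open>B b\<close> and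
  \<open>B a\<close>, and also one of \<open>B c\<close> and \<open>B a\<close>. The left inverse
  belonging to \<open>b\<close> annihilates the second form, so the coefficient
  \<open>C a * G\<close> of \<open>B b\<close> vanishes and only a multiple of \<open>B a\<close>
  remains.\<close>

lemma commutator_images_inter:
  assumes ext: "block_extension n q S A B C D" and nd: "nondegenerate n q T B C" and TS: "T \<subseteq> S"
    and T: "a \<in> T" "b \<in> T" "c \<in> T" "a \<noteq> b" "a \<noteq> c" "b \<noteq> c"
    and G: "G \<in> carrier_mat n s" "G' \<in> carrier_mat n s"
    and eq: "commutator (A a) (A b) * G = commutator (A a) (A c) * G'"
  shows "commutator (A a) (A b) * G = B a * (- (C b * G))"
proof -
  have S: "a \<in> S" "b \<in> S" "c \<in> S" using T TS by auto
  note c = block_extensionD[OF ext S(1)] block_extensionD[OF ext S(2)] block_extensionD[OF ext S(3)]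
  obtain R where R: "R \<in> carrier_mat q n" "R * B b = 1\<^sub>m q" "R * B a = 0\<^sub>m q q" "R * B c = 0\<^sub>m q q"
    using nondegenerateE[OF nd] T by metis
  have RB: "R * (B b * W) = W" "R * (B a * W) = 0\<^sub>m q s" "R * (B c * W) = 0\<^sub>m q s"
    if W: "W \<in> carrier_mat q s" for W
    using R c W by (simp_all add: mat_assoc[symmetric])
  have 1: "commutator (A a) (A b) * G = B b * (C a * G) - B a * (C b * G)"
    and 2: "commutator (A a) (A c) * G' = B c * (C a * G') - B a * (C c * G')"
    using c G S by (simp_all add: block_extension_commutator(1)[OF ext] mat_algebra)
  have "R * (B b * (C a * G) - B a * (C b * G)) = C a * G"
    "R * (B c * (C a * G') - B a * (C c * G')) = 0\<^sub>m q s"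
    using c G R by (simp_all add: mat_mult_minus RB mat_diff_zero)
  then have "C a * G = 0\<^sub>m q s" using eq unfolding 1 2 by simp
  then show ?thesis unfolding 1 using c G by (simp add: mat_zero_diff)
qed

text \<open>The converse inclusion: if \<open>C b * Y\<close> is 1 and \<open>C a * Y\<close> is 0,
  then \<open>B b * C a - B a * C b\<close> sends \<open>Y\<close> to \<open>- B a\<close>, whence
  the witness \<open>- Y\<close>.\<close>

lemma B_in_commutator_image:
  assumes ext: "block_extension n q S A B C D" and nd: "nondegenerate n q T B C" and TS: "T \<subseteq> S"
    and T: "a \<in> T" "b \<in> T" "a \<noteq> b"
  obtains G where "G \<in> carrier_mat n q" "B a = commutator (A a) (A b) * G"
proof -
  have S: "a \<in> S" "b \<in> S" using T TS by auto
  note c = block_extensionD[OF ext S(1)] block_extensionD[OF ext S(2)]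
  obtain Y where Y: "Y \<in> carrier_mat n q" "C b * Y = 1\<^sub>m q" "C a * Y = 0\<^sub>m q q"
    using nondegenerate_right_inverse[OF nd T(2,1)] T(3) by metis
  have "commutator (A a) (A b) * Y = - B a"
    using c Y S by (simp add: block_extension_commutator(1)[OF ext] mat_algebra)
  then have "commutator (A a) (A b) * (- Y) = B a"
    using c Y by (simp add: commutator_def)
  then show thesis using that[of "- Y"] Y by simp
qed

text \<open>By the second extension the columns of \<open>B' a\<close> lie in two commutator images,
  and by the first one these images meet inside the column space of \<open>B a\<close>.\<close>

lemma B_unique_up_to_factor:
  assumes ext: "block_extension n q S A B C D" "block_extension n q S A B' C' D'"
    and nd: "nondegenerate n q T B C" "nondegenerate n q T B' C'" and TS: "T \<subseteq> S"
    and third: "\<And>a b. a \<in> T \<Longrightarrow> b \<in> T \<Longrightarrow> \<exists>c\<in>T. c \<noteq> a \<and> c \<noteq> b"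
    and a: "a \<in> T"
  shows "\<exists>M\<in>carrier_mat q q. B' a = B a * M"
proof -
  obtain b where b: "b \<in> T" "b \<noteq> a" using third[OF a a] by auto
  obtain c where c: "c \<in> T" "c \<noteq> a" "c \<noteq> b" using third[OF a b(1)] by auto
  obtain G where G: "G \<in> carrier_mat n q" "B' a = commutator (A a) (A b) * G"
    using B_in_commutator_image[OF ext(2) nd(2) TS a b(1)] b by metis
  obtain G' where G': "G' \<in> carrier_mat n q" "B' a = commutator (A a) (A c) * G'"
    using B_in_commutator_image[OF ext(2) nd(2) TS a c(1)] c by metis
  have "B' a = B a * (- (C b * G))"
    using commutator_images_inter[OF ext(1) nd(1) TS a b(1) c(1) _ _ _ G(1) G'(1)] G(2) G'(2) b c by auto
  moreover have "- (C b * G) \<in> carrier_mat q q"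
    using block_extensionD[OF ext(1), of b] b TS G by auto
  ultimately show ?thesis by blast
qed

text \<open>Together \<open>third\<close> and \<open>ne\<close> say that \<open>T\<close> has at
  least three elements. The commutators relate the factor of one index to the block \<open>C\<close>
  of another, and a third index is what allows the factors of two indices to be compared.\<close>

lemma unique_on_triple:
  assumes ext: "block_extension n q S A B C D" "block_extension n q S A B' C' D'"
    and nd: "nondegenerate n q T B C" "nondegenerate n q T B' C'" and TS: "T \<subseteq> S"
    and third: "\<And>a b. a \<in> T \<Longrightarrow> b \<in> T \<Longrightarrow> \<exists>c\<in>T. c \<noteq> a \<and> c \<noteq> b"
    and ne: "T \<noteq> {}"
  shows "\<exists>M\<in>carrier_mat q q. \<exists>N\<in>carrier_mat q q. M * N = 1\<^sub>m q \<and>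
    (\<forall>a\<in>T. B' a = B a * M \<and> C a = M * C' a \<and> D a * M = M * D' a)"
proof -
  have "\<forall>a\<in>T. \<exists>M. M \<in> carrier_mat q q \<and> B' a = B a * M"
    using B_unique_up_to_factor[OF ext nd TS third] by blast
  then obtain M where M: "\<And>a. a \<in> T \<Longrightarrow> M a \<in> carrier_mat q q" "\<And>a. a \<in> T \<Longrightarrow> B' a = B a * M a"
    by metis
  obtain R where R: "\<And>a. a \<in> T \<Longrightarrow> R a \<in> carrier_mat q n" "\<And>a. a \<in> T \<Longrightarrow> R a * B a = 1\<^sub>m q"
    "\<And>a b. a \<in> T \<Longrightarrow> b \<in> T \<Longrightarrow> a \<noteq> b \<Longrightarrow> R a * B b = 0\<^sub>m q q"
    using nondegenerateE[OF nd(1)] by metis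
  \<comment> \<open>The commutator is the same for both extensions; compare the coefficients of
    \<open>B b\<close>.\<close>
  have CM: "C a = M b * C' a" if T: "a \<in> T" "b \<in> T" "a \<noteq> b" for a b
  proof -
    have S: "a \<in> S" "b \<in> S" using T TS by auto
    note c = block_extensionD[OF ext(1) S(1)] block_extensionD[OF ext(1) S(2)]
      block_extensionD[OF ext(2) S(1)] block_extensionD[OF ext(2) S(2)] M(1)[OF T(1)] M(1)[OF T(2)]
    have "B b * C a - B a * C b = B' b * C' a - B' a * C' b"
      using block_extension_commutator(1)[OF ext(1) S] block_extension_commutator(1)[OF ext(2) S] by simp
    also have "\<dots> = B b * (M b * C' a) - B a * (M a * C' b)"
      using c T by (simp add: M(2) mat_algebra)
    finally have eq: "B b * C a - B a * C b = B b * (M b * C' a) - B a * (M a * C' b)" .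
    have "M b * C' a \<in> carrier_mat q n" "M a * C' b \<in> carrier_mat q n" using c by auto
    then show ?thesis
      using two_blocks_cancel(1)[OF c(6,2) R(1)[OF T(2)] R(1)[OF T(1)] R(2)[OF T(2)] R(3)[OF T(2,1)]
        R(3)[OF T] R(2)[OF T(1)] c(3,7) _ _ eq] T(3) by blast
  qed
  \<comment> \<open>For a third index \<open>a\<close>, both \<open>M b * C' a\<close> and
    \<open>M c * C' a\<close> equal \<open>C a\<close>, and \<open>C' a\<close> has a right
    inverse.\<close>
  have MM: "M b = M c" if bc: "b \<in> T" "c \<in> T" for b c
  proof -
    obtain a where a: "a \<in> T" "a \<noteq> b" "a \<noteq> c" using third[OF bc] by auto
    obtain Y where Y: "Y \<in> carrier_mat n q" "C' a * Y = 1\<^sub>m q"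
      using nondegenerate_right_inverse[OF nd(2) a(1) bc(1) a(2)] by metis
    note c = block_extensionD[OF ext(2) subsetD[OF TS a(1)]] M(1)[OF bc(1)] M(1)[OF bc(2)]
    have "M b * C' a * Y = M c * C' a * Y" using CM[OF a(1) bc(1) a(2)] CM[OF a(1) bc(2) a(3)] by simp
    then show ?thesis using c Y by (simp add: mat_assoc)
  qed
  obtain e where e: "e \<in> T" using ne by auto
  have Me: "M a = M e" if "a \<in> T" for a using MM[OF that e] .
  \<comment> \<open>Exchanging the two extensions gives a factor in the other direction; cancelling
    \<open>B e\<close> in \<open>B e = B e * (M e * N)\<close> makes it the inverse of
    \<open>M e\<close>.\<close>
  obtain N where N: "N \<in> carrier_mat q q" "B e = B' e * N"
    using B_unique_up_to_factor[OF ext(2,1) nd(2,1) TS third e] by auto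
  note ce = block_extensionD[OF ext(1) subsetD[OF TS e]] M(1)[OF e] R(1)[OF e]
  have "R e * B e = R e * (B e * (M e * N))"
    using N M(2)[OF e] ce by (simp add: mat_assoc)
  also have "\<dots> = (R e * B e) * (M e * N)" using ce N(1) by (simp add: mat_assoc)
  finally have MN: "M e * N = 1\<^sub>m q" using R(2)[OF e] ce N(1) by simp
  have "B' a = B a * M e \<and> C a = M e * C' a \<and> D a * M e = M e * D' a" if a: "a \<in> T" for a
  proof -
    obtain b where b: "b \<in> T" "b \<noteq> a" using third[OF a a] by auto
    have S: "a \<in> S" "b \<in> S" using a b TS by auto
    note c = block_extensionD[OF ext(1) S(1)] block_extensionD[OF ext(1) S(2)]
      block_extensionD[OF ext(2) S(1)] block_extensionD[OF ext(2) S(2)] M(1)[OF e]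
    have B': "B' a = B a * M e" "B' b = B b * M e" using M(2) Me a b by metis+
    \<comment> \<open>The same comparison of coefficients, now in the upper right block multiplied
      by \<open>M e\<close> from the right.\<close>
    have "B b * (D a * M e) - B a * (D b * M e) = (B b * D a - B a * D b) * M e"
      using c by (simp add: mat_algebra)
    also have "\<dots> = (A a * B b - A b * B a) * M e"
      using block_extension_commutator(2)[OF ext(1) S] by simp
    also have "\<dots> = A a * B' b - A b * B' a" unfolding B' using c by (simp add: mat_algebra)
    also have "\<dots> = B' b * D' a - B' a * D' b" by (rule block_extension_commutator(2)[OF ext(2) S])
    also have "\<dots> = B b * (M e * D' a) - B a * (M e * D' b)" unfolding B' using c by (simp add: mat_algebra)
    finally have eq: "B b * (D a * M e) - B a * (D b * M e) = B b * (M e * D' a) - B a * (M e * D' b)" .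
    have "D a * M e \<in> carrier_mat q q" "D b * M e \<in> carrier_mat q q"
      "M e * D' a \<in> carrier_mat q q" "M e * D' b \<in> carrier_mat q q" using c by auto
    then have "D a * M e = M e * D' a"
      using two_blocks_cancel(1)[OF c(6,2) R(1)[OF b(1)] R(1)[OF a] R(2)[OF b(1)] R(3)[OF b(1) a]
        R(3)[OF a b(1)] R(2)[OF a] _ _ _ _ eq] b(2) by blast
    then show ?thesis using B' CM[OF a b(1)] Me[OF b(1)] b by auto
  qed
  then show ?thesis using MN N ce by blast
qed

lemma triple_third:
  assumes "k \<noteq> l" "k \<noteq> m" "l \<noteq> m" "a \<in> {k, l, m}" "b \<in> {k, l, m}"
  shows "\<exists>c\<in>{k, l, m}. c \<noteq> a \<and> c \<noteq> b"
  using assms by auto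

text \<open>All triples share the index \<open>k\<close>, and \<open>B k\<close> is left invertible.
  The factor is therefore determined by \<open>B' k = B k * M\<close> and is the same for every
  triple.\<close>

lemma block_extension_unique:
  assumes ext: "block_extension n q S A B C D" "block_extension n q S A B' C' D'"
    and k: "k \<in> S" and S: "S \<noteq> {k}"
    and full: "\<And>l. l \<in> S - {k} \<Longrightarrow> \<exists>m\<in>S - {k, l}. full_rank_triple n q A k l m"
  shows "\<exists>M\<in>carrier_mat q q. \<exists>N\<in>carrier_mat q q. M * N = 1\<^sub>m q \<and> N * M = 1\<^sub>m q \<and>
    (\<forall>i\<in>S. B' i = B i * M \<and> C' i = N * C i \<and> D' i = N * D i * M)"
proof -
  have step: "\<exists>M\<in>carrier_mat q q. \<exists>N\<in>carrier_mat q q. M * N = 1\<^sub>m q \<and> 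
    (\<forall>a\<in>{k, l}. B' a = B a * M \<and> C a = M * C' a \<and> D a * M = M * D' a) \<and>
    (\<exists>R\<in>carrier_mat q n. R * B k = 1\<^sub>m q)" if l: "l \<in> S - {k}" for l
  proof -
    obtain m where m: "m \<in> S - {k, l}" and f: "full_rank_triple n q A k l m" using full[OF l] by auto
    have dist: "k \<noteq> l" "k \<noteq> m" "l \<noteq> m" and lS: "l \<in> S" and mS: "m \<in> S" using l m by auto
    note nd = full_rank_triple_imp_nondegenerate[OF ext(1) k lS mS dist f]
      full_rank_triple_imp_nondegenerate[OF ext(2) k lS mS dist f]
    have "{k, l, m} \<subseteq> S" using k lS mS by auto
    from unique_on_triple[OF ext nd this triple_third[OF dist]]
    show ?thesis using nondegenerateE[OF nd(1)] by (metis insert_iff insert_not_empty)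
  qed
  obtain l0 where l0: "l0 \<in> S - {k}" using k S by auto
  from step[OF l0] obtain M N R where M: "M \<in> carrier_mat q q" and N: "N \<in> carrier_mat q q"
    and MN: "M * N = 1\<^sub>m q" and R: "R \<in> carrier_mat q n" "R * B k = 1\<^sub>m q"
    and eqk: "B' k = B k * M" "C k = M * C' k" "D k * M = M * D' k" by auto
  have NM: "N * M = 1\<^sub>m q" by (rule mat_mult_left_right_inverse[OF M N MN])
  have "B' i = B i * M \<and> C i = M * C' i \<and> D i * M = M * D' i" if i: "i \<in> S" for i
  proof (cases "i = k")
    case False
    with i have "i \<in> S - {k}" by auto
    from step[OF this] obtain M' where M': "M' \<in> carrier_mat q q"
      and eq: "B' k = B k * M'" "B' i = B i * M'" "C i = M' * C' i" "D i * M' = M' * D' i" by auto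
    have "R * (B k * M) = R * (B k * M')" using eq(1) eqk(1) by simp
    then have "R * B k * M = R * B k * M'"
      using R(1) M M' block_extensionD[OF ext(1) k] by (simp add: mat_assoc)
    then have "M = M'" using R M M' by simp
    then show ?thesis using eq by simp
  qed (use eqk in simp)
  moreover have "C' i = N * (M * C' i)" "D' i = N * (M * D' i)" if "i \<in> S" for i
    using block_extensionD[OF ext(2) that] M N NM by (simp_all add: mat_assoc[symmetric])
  ultimately have "B' i = B i * M \<and> C' i = N * C i \<and> D' i = N * D i * M" if i: "i \<in> S" for i
    using block_extensionD[OF ext(1) i] M N i by (simp add: mat_assoc)
  then show ?thesis using M N MN NM by blast
qed

subsection \<open>Descent to a subfield\<close>

text \<open>Taking \<open>y = 1\<close> shows that \<open>p\<close> is idempotent; its fixed points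
  form a subfield over which \<open>p\<close> is linear. With the subfield inside the type of the
  large field, all matrices have the same type.\<close>

locale subfield_projection =
  fixes p :: "'b :: field \<Rightarrow> 'b"
  assumes p_add: "p (x + y) = p x + p y"
    and p_mult: "p (p x * y) = p x * p y"
    and p_one: "p 1 = 1"
begin

lemma p_zero: "p 0 = 0"
  by (metis add.right_neutral add_left_cancel p_add)

lemma p_minus: "p (x - y) = p x - p y"
  using p_add[of "x - y" y] by (simp add: algebra_simps)

lemma p_sum: "p (sum f I) = (\<Sum>i\<in>I. p (f i))"
  by (induction I rule: infinite_finite_induct) (simp_all add: p_add p_zero)

text \<open>As \<open>p\<close> is idempotent, these are exactly the matrices with entries in the
  subfield.\<close>

definition fixed :: "'b mat \<Rightarrow> bool" where
  "fixed U \<longleftrightarrow> map_mat p U = U"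

lemma map_mat_p_minus:
  "dim_row U = dim_row V \<Longrightarrow> dim_col U = dim_col V \<Longrightarrow> map_mat p (U - V) = map_mat p U - map_mat p V"
  by (intro eq_matI) (simp_all add: p_minus)

lemma map_mat_p_one: "map_mat p (1\<^sub>m n) = 1\<^sub>m n"
  by (intro eq_matI) (simp_all add: p_one p_zero)

lemma fixed_index: "fixed U \<Longrightarrow> i < dim_row U \<Longrightarrow> j < dim_col U \<Longrightarrow> p (U $$ (i, j)) = U $$ (i, j)"
  unfolding fixed_def by (metis index_map_mat(1))

text \<open>Linearity of \<open>p\<close> over its fixed points, entry by entry: a factor over the
  subfield can be pulled out.\<close>

lemma map_mat_p_mult_left:
  assumes "fixed U" "dim_col U = dim_row V"
  shows "map_mat p (U * V) = U * map_mat p V"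
proof (intro eq_matI)
  fix i j assume ij: "i < dim_row (U * map_mat p V)" "j < dim_col (U * map_mat p V)"
  have "p (U $$ (i, k) * V $$ (k, j)) = U $$ (i, k) * p (V $$ (k, j))" if "k < dim_row V" for k
    using p_mult[of "U $$ (i, k)"] fixed_index[OF assms(1), of i k] ij that assms(2) by simp
  then show "map_mat p (U * V) $$ (i, j) = (U * map_mat p V) $$ (i, j)"
    using ij assms(2) by (simp add: scalar_prod_def p_sum)
qed auto

lemma map_mat_p_mult_right:
  assumes "fixed V" "dim_col U = dim_row V"
  shows "map_mat p (U * V) = map_mat p U * V"
proof (intro eq_matI)
  fix i j assume ij: "i < dim_row (map_mat p U * V)" "j < dim_col (map_mat p U * V)"
  have "p (U $$ (i, k) * V $$ (k, j)) = p (U $$ (i, k)) * V $$ (k, j)" if "k < dim_row V" for k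
    using p_mult[of "V $$ (k, j)"] fixed_index[OF assms(1), of k j] ij that assms(2)
    by (simp add: mult.commute)
  then show "map_mat p (U * V) $$ (i, j) = (map_mat p U * V) $$ (i, j)"
    using ij assms(2) by (simp add: scalar_prod_def p_sum)
qed auto

lemma fixed_mult: "fixed U \<Longrightarrow> fixed V \<Longrightarrow> dim_col U = dim_row V \<Longrightarrow> fixed (U * V)"
  using map_mat_p_mult_left unfolding fixed_def by simp

lemma fixed_minus:
  "fixed U \<Longrightarrow> fixed V \<Longrightarrow> dim_row U = dim_row V \<Longrightarrow> dim_col U = dim_col V \<Longrightarrow> fixed (U - V)"
  using map_mat_p_minus unfolding fixed_def by simp

lemma fixed_commutator:
  "U \<in> carrier_mat n n \<Longrightarrow> V \<in> carrier_mat n n \<Longrightarrow> fixed U \<Longrightarrow> fixed V \<Longrightarrow> fixed (commutator U V)"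
  unfolding commutator_def by (intro fixed_minus fixed_mult) auto

text \<open>Applying \<open>p\<close> to the entries of \<open>U0\<close> and \<open>U1\<close>
  gives another solution of the same linear system over the subfield, and this system has only one
  solution.\<close>

lemma fixed_of_two_blocks:
  assumes B: "B0 \<in> carrier_mat n q" "B1 \<in> carrier_mat n q"
    and R: "R0 \<in> carrier_mat q n" "R1 \<in> carrier_mat q n"
    "R0 * B0 = 1\<^sub>m q" "R0 * B1 = 0\<^sub>m q q" "R1 * B0 = 0\<^sub>m q q" "R1 * B1 = 1\<^sub>m q"
    and U: "U0 \<in> carrier_mat q s" "U1 \<in> carrier_mat q s"
    and fixed: "fixed B0" "fixed B1" "fixed (B0 * U0 - B1 * U1)"
  shows "fixed U0"
proof -
  have "B0 * map_mat p U0 - B1 * map_mat p U1 = map_mat p (B0 * U0 - B1 * U1)"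
    using B U fixed(1,2) by (simp add: map_mat_p_minus map_mat_p_mult_left)
  also have "\<dots> = B0 * U0 - B1 * U1" using fixed(3) unfolding fixed_def .
  finally have eq: "B0 * map_mat p U0 - B1 * map_mat p U1 = B0 * U0 - B1 * U1" .
  have "map_mat p U0 \<in> carrier_mat q s" "map_mat p U1 \<in> carrier_mat q s" using U by auto
  from two_blocks_cancel(1)[OF B R this U eq] show ?thesis unfolding fixed_def .
qed

text \<open>Normalise \<open>B a\<close> so that some \<open>q\<close> of its rows form the identity matrix. Its projection still
  has its columns in both commutator images, hence in the column space of \<open>B a\<close>, and it has the
  same \<open>q\<close> rows, hence it is the same matrix.\<close>

lemma fixed_column_basis:
  assumes ext: "block_extension n q S A B C D" and nd: "nondegenerate n q T B C" and TS: "T \<subseteq> S"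
    and third: "\<And>a b. a \<in> T \<Longrightarrow> b \<in> T \<Longrightarrow> \<exists>c\<in>T. c \<noteq> a \<and> c \<noteq> b"
    and fixA: "\<And>a. a \<in> T \<Longrightarrow> fixed (A a)" and a: "a \<in> T"
  shows "\<exists>M\<in>carrier_mat q q. \<exists>N\<in>carrier_mat q q. M * N = 1\<^sub>m q \<and> N * M = 1\<^sub>m q \<and> fixed (B a * M)"
proof -
  obtain b where b: "b \<in> T" "b \<noteq> a" using third[OF a a] by auto
  obtain c where c: "c \<in> T" "c \<noteq> a" "c \<noteq> b" using third[OF a b(1)] by auto
  have S: "a \<in> S" "b \<in> S" "c \<in> S" using a b c TS by auto
  note cs = block_extensionD[OF ext S(1)] block_extensionD[OF ext S(2)] block_extensionD[OF ext S(3)]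
  let ?P = "commutator (A a) (A b)" and ?Q = "commutator (A a) (A c)"
  have PQ: "?P \<in> carrier_mat n n" "?Q \<in> carrier_mat n n" using cs unfolding commutator_def by auto
  have fixPQ: "fixed ?P" "fixed ?Q" using fixed_commutator cs fixA a b c by metis+
  obtain G where G: "G \<in> carrier_mat n q" "B a = ?P * G"
    using B_in_commutator_image[OF ext nd TS a b(1)] b by metis
  obtain G' where G': "G' \<in> carrier_mat n q" "B a = ?Q * G'"
    using B_in_commutator_image[OF ext nd TS a c(1)] c by metis
  obtain R where R: "R \<in> carrier_mat q n" "R * B a = 1\<^sub>m q"
    using nondegenerateE[OF nd] a by metis
  obtain I M where I: "I \<in> carrier_mat q n" and M: "M \<in> carrier_mat q q"
    and I01: "\<forall>i<q. \<forall>j<n. I $$ (i, j) \<in> {0, 1}" and IBM: "I * (B a * M) = 1\<^sub>m q"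
    using left_inverse_imp_invertible_minor[OF cs(2) R] by blast
  \<comment> \<open>The row selection \<open>I\<close> commutes with \<open>p\<close> because its
    entries 0 and 1 are fixed.\<close>
  have "p (I $$ (i, j)) = I $$ (i, j)" if "i < q" "j < n" for i j
    using I01 that p_zero p_one by (metis insert_iff singletonD)
  then have fixI: "fixed I"
    unfolding fixed_def using I by (intro eq_matI) auto
  define N where "N = I * B a"
  have N: "N \<in> carrier_mat q q" using I cs unfolding N_def by auto
  have NM: "N * M = 1\<^sub>m q" unfolding N_def using IBM I M cs by (simp add: mat_assoc)
  have MN: "M * N = 1\<^sub>m q" by (rule mat_mult_left_right_inverse[OF N M NM])
  let ?U = "B a * M"
  have U: "?U = ?P * (G * M)" "?U = ?Q * (G' * M)"
    using G(2) G'(2) G(1) G'(1) PQ M by (metis carrier_matD mat_assoc)+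
  have pU: "map_mat p ?U = ?P * map_mat p (G * M)" "map_mat p ?U = ?Q * map_mat p (G' * M)"
    using map_mat_p_mult_left[OF fixPQ(1), of "G * M"] map_mat_p_mult_left[OF fixPQ(2), of "G' * M"]
      U PQ G(1) G'(1) by auto
  have pc: "map_mat p (G * M) \<in> carrier_mat n q" "map_mat p (G' * M) \<in> carrier_mat n q"
    using G(1) G'(1) M by auto
  define W where "W = - (C b * map_mat p (G * M))"
  have W: "W \<in> carrier_mat q q" unfolding W_def using cs pc by auto
  have pUW: "map_mat p ?U = B a * W"
    using commutator_images_inter[OF ext nd TS a b(1) c(1) _ _ _ pc] pU b c unfolding W_def by metis
  have "N * W = I * map_mat p ?U" unfolding pUW N_def using I cs W by (simp add: mat_assoc)
  also have "\<dots> = map_mat p (I * ?U)" using map_mat_p_mult_left[OF fixI, of ?U] I cs by simp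
  also have "\<dots> = N * M" unfolding IBM NM map_mat_p_one ..
  finally have "M * (N * W) = M * (N * M)" by simp
  then have "W = M" using M N W MN by (simp add: mat_assoc[symmetric])
  then have "fixed ?U" using pUW unfolding fixed_def by simp
  then show ?thesis using M N MN NM by blast
qed

text \<open>Each \<open>B a\<close> is first normalised by a factor \<open>M a\<close> of its own,
  with inverse \<open>N a\<close>. The commutators then show that \<open>N b * C a\<close> is fixed
  for \<open>a \<noteq> b\<close>. As \<open>N k\<close> is 1, this covers \<open>C a\<close> for
  \<open>a \<noteq> k\<close>; from these follow every \<open>N b\<close>, then every
  \<open>B a\<close>, the remaining \<open>C k\<close>, and finally the \<open>D a\<close>.\<close>

lemma fixed_on_triple:
  assumes ext: "block_extension n q S A B C D" and nd: "nondegenerate n q T B C" and TS: "T \<subseteq> S"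
    and third: "\<And>a b. a \<in> T \<Longrightarrow> b \<in> T \<Longrightarrow> \<exists>c\<in>T. c \<noteq> a \<and> c \<noteq> b"
    and fixA: "\<And>a. a \<in> T \<Longrightarrow> fixed (A a)" and k: "k \<in> T" and fixBk: "fixed (B k)" and a: "a \<in> T"
  shows "fixed (B a)" "fixed (C a)" "fixed (D a)"
proof -
  note cs = block_extensionD[OF ext subsetD[OF TS]]
  \<comment> \<open>For \<open>a = k\<close> the factor 1 is taken, which is possible because
    \<open>B k\<close> is fixed already; this choice is what makes the other factors
    comparable.\<close>
  have "\<forall>a\<in>T. \<exists>M N. M \<in> carrier_mat q q \<and> N \<in> carrier_mat q q \<and> M * N = 1\<^sub>m q \<and> N * M = 1\<^sub>m q \<and>
      fixed (B a * M) \<and> (a = k \<longrightarrow> N = 1\<^sub>m q)"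
  proof
    fix a assume a: "a \<in> T"
    show "\<exists>M N. M \<in> carrier_mat q q \<and> N \<in> carrier_mat q q \<and> M * N = 1\<^sub>m q \<and> N * M = 1\<^sub>m q \<and>
      fixed (B a * M) \<and> (a = k \<longrightarrow> N = 1\<^sub>m q)"
    proof (cases "a = k")
      case True
      then show ?thesis using fixBk cs(2)[OF k] by (intro exI[of _ "1\<^sub>m q"]) auto
    next
      case False
      then show ?thesis using fixed_column_basis[OF ext nd TS third fixA a] by blast
    qed
  qed
  then obtain M N where M: "\<And>a. a \<in> T \<Longrightarrow> M a \<in> carrier_mat q q" and N: "\<And>a. a \<in> T \<Longrightarrow> N a \<in> carrier_mat q q"
    and MN: "\<And>a. a \<in> T \<Longrightarrow> M a * N a = 1\<^sub>m q" and NM: "\<And>a. a \<in> T \<Longrightarrow> N a * M a = 1\<^sub>m q"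
    and fixBM: "\<And>a. a \<in> T \<Longrightarrow> fixed (B a * M a)" and Nk: "N k = 1\<^sub>m q"
    using k by metis
  obtain R where R: "\<And>a. a \<in> T \<Longrightarrow> R a \<in> carrier_mat q n" "\<And>a. a \<in> T \<Longrightarrow> R a * B a = 1\<^sub>m q"
    "\<And>a b. a \<in> T \<Longrightarrow> b \<in> T \<Longrightarrow> a \<noteq> b \<Longrightarrow> R a * B b = 0\<^sub>m q q"
    using nondegenerateE[OF nd] by metis
  have MNW: "M a * (N a * W) = W" if "a \<in> T" "dim_row W = q" for a W
    using M[OF that(1)] N[OF that(1)] MN[OF that(1)] that(2) by (simp add: mat_assoc[symmetric])
  have fixNC: "fixed (N b * C a)" if ab: "a \<in> T" "b \<in> T" "a \<noteq> b" for a b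
  proof -
    note c = cs[OF ab(1)] cs[OF ab(2)] M[OF ab(1)] M[OF ab(2)] N[OF ab(1)] N[OF ab(2)]
      R(1)[OF ab(1)] R(1)[OF ab(2)]
    have U: "B b * M b \<in> carrier_mat n q" "B a * M a \<in> carrier_mat n q"
      and R': "N b * R b \<in> carrier_mat q n" "N a * R a \<in> carrier_mat q n"
      and NC: "N b * C a \<in> carrier_mat q n" "N a * C b \<in> carrier_mat q n" using c by auto
    have RB: "N i * R i * (B j * M j) = N i * ((R i * B j) * M j)" if "i \<in> {a, b}" "j \<in> {a, b}" for i j
      using that c by (auto simp: mat_assoc)
    have d: "(N b * R b) * (B b * M b) = 1\<^sub>m q" "(N b * R b) * (B a * M a) = 0\<^sub>m q q"
      "(N a * R a) * (B b * M b) = 0\<^sub>m q q" "(N a * R a) * (B a * M a) = 1\<^sub>m q"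
      using c ab R(2,3) by (auto simp: RB NM)
    \<comment> \<open>Cancelling \<open>M * N\<close> between \<open>B\<close> and \<open>C\<close>
      identifies the commutator as a combination whose left factors are over the subfield.\<close>
    have "(B b * M b) * (N b * C a) - (B a * M a) * (N a * C b) = B b * C a - B a * C b"
      using c ab by (simp add: mat_assoc MNW)
    also have "\<dots> = commutator (A a) (A b)"
      using block_extension_commutator(1)[OF ext subsetD[OF TS ab(1)] subsetD[OF TS ab(2)]] by simp
    finally have "fixed ((B b * M b) * (N b * C a) - (B a * M a) * (N a * C b))"
      using fixed_commutator[OF c(1,5)] fixA ab by simp
    from fixed_of_two_blocks[OF U R' d NC fixBM[OF ab(2)] fixBM[OF ab(1)] this]
    show ?thesis .
  qed
  have fixC': "fixed (C a)" if "a \<in> T" "a \<noteq> k" for a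
    using fixNC[OF that(1) k that(2)] cs(3)[OF that(1)] Nk by simp
  have fixN: "fixed (N b)" if b: "b \<in> T" for b
  proof -
    \<comment> \<open>The index \<open>a\<close> avoids \<open>b\<close>, so that
      \<open>N b * C a\<close> is fixed, and \<open>k\<close>, so that \<open>C a\<close> itself is
      fixed.\<close>
    obtain a where a: "a \<in> T" "a \<noteq> b" "a \<noteq> k" using third[OF b k] by auto
    obtain Y where Y: "Y \<in> carrier_mat n q" "C a * Y = 1\<^sub>m q"
      using nondegenerate_right_inverse[OF nd a(1) b a(2)] by metis
    note c = cs[OF a(1)] N[OF b]
    have "map_mat p (N b) * C a = N b * C a"
      using map_mat_p_mult_right[OF fixC'[OF a(1,3)], of "N b"] fixNC[OF a(1) b a(2)] c
      unfolding fixed_def by simp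
    then have "map_mat p (N b) * C a * Y = N b * C a * Y" by simp
    then show ?thesis using c Y unfolding fixed_def by (simp add: mat_assoc)
  qed
  have fixB: "fixed (B a)" if a: "a \<in> T" for a
  proof -
    have "B a * M a * N a = B a" using cs[OF a] M[OF a] N[OF a] MN[OF a] by (simp add: mat_assoc)
    then show ?thesis
      using fixed_mult[OF fixBM[OF a] fixN[OF a]] M[OF a] N[OF a] by simp
  qed
  have fixC: "fixed (C a)" if a: "a \<in> T" for a
  proof (cases "a = k")
    case True
    \<comment> \<open>The choice \<open>N k = 1\<close> does not reach \<open>C k\<close>; it is
      recovered from the fixed \<open>N b * C k\<close> by cancelling the fixed invertible
      \<open>N b\<close> of another index.\<close>
    obtain b where b: "b \<in> T" "b \<noteq> a" using third[OF a a] by auto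
    note c = cs[OF a] M[OF b(1)] N[OF b(1)]
    have "N b * map_mat p (C a) = N b * C a"
      using map_mat_p_mult_left[OF fixN[OF b(1)], of "C a"] fixNC[OF a b(1)] b c
      unfolding fixed_def by simp
    then have "M b * (N b * map_mat p (C a)) = M b * (N b * C a)" by simp
    then show ?thesis using c b unfolding fixed_def by (simp add: MNW)
  qed (use fixC' a in simp)
  obtain b where b: "b \<in> T" "b \<noteq> a" using third[OF a a] by auto
  note c = cs[OF a] cs[OF b(1)]
  have "fixed (A a * B b - A b * B a)"
    using c fixA fixB a b by (intro fixed_minus fixed_mult) auto
  then have "fixed (B b * D a - B a * D b)"
    using block_extension_commutator(2)[OF ext subsetD[OF TS a] subsetD[OF TS b(1)]] by simp
  from fixed_of_two_blocks[OF c(6,2) R(1)[OF b(1)] R(1)[OF a] R(2)[OF b(1)] R(3)[OF b(1) a b(2)]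
    R(3)[OF a b(1) b(2)[symmetric]] R(2)[OF a] c(4,8) fixB[OF b(1)] fixB[OF a] this]
  show "fixed (D a)" .
  show "fixed (B a)" "fixed (C a)" using fixB fixC a by auto
qed

end

text \<open>This is conjugation of the block matrices by the block diagonal matrix with blocks 1 and
  \<open>M\<close>; the products \<open>M * N\<close> arising between neighbouring blocks
  cancel.\<close>

lemma block_extension_conj:
  assumes ext: "block_extension n q S A B C D"
    and M: "M \<in> carrier_mat q q" and N: "N \<in> carrier_mat q q" and MN: "M * N = 1\<^sub>m q"
  shows "block_extension n q S A (\<lambda>i. B i * M) (\<lambda>i. N * C i) (\<lambda>i. N * D i * M)"
proof -
  have MNW: "M * (N * W) = W" if "dim_row W = q" for W
    using M N MN that by (simp add: mat_assoc[symmetric])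
  {
    fix i j assume i: "i \<in> S" and j: "j \<in> S"
    note c = block_extensionD[OF ext i] block_extensionD[OF ext j] M N
    have e: "A i * A j + B i * C j = A j * A i + B j * C i" "A i * B j + B i * D j = A j * B i + B j * D i"
      "C i * A j + D i * C j = C j * A i + D j * C i" "C i * B j + D i * D j = C j * B i + D j * D i"
      using ext i j unfolding block_extension_def by auto
    have "A i * A j + B i * M * (N * C j) = A j * A i + B j * M * (N * C i)"
      using c e(1) by (simp add: mat_assoc MNW)
    moreover have "A i * (B j * M) + B i * M * (N * D j * M) = (A i * B j + B i * D j) * M"
      "(A j * B i + B j * D i) * M = A j * (B i * M) + B j * M * (N * D i * M)"
      using c by (simp_all add: mat_assoc mat_add_mult MNW)
    moreover have "N * C i * A j + N * D i * M * (N * C j) = N * (C i * A j + D i * C j)"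
      "N * (C j * A i + D j * C i) = N * C j * A i + N * D j * M * (N * C i)"
      using c by (simp_all add: mat_assoc mat_mult_add MNW)
    moreover have "N * C i * (B j * M) + N * D i * M * (N * D j * M) = N * ((C i * B j + D i * D j) * M)"
      "N * ((C j * B i + D j * D i) * M) = N * C j * (B i * M) + N * D j * M * (N * D i * M)"
      using c by (simp_all add: mat_assoc mat_mult_add mat_add_mult MNW)
    moreover note e
    ultimately have "A i * A j + B i * M * (N * C j) = A j * A i + B j * M * (N * C i) \<and>
        A i * (B j * M) + B i * M * (N * D j * M) = A j * (B i * M) + B j * M * (N * D i * M) \<and>
        N * C i * A j + N * D i * M * (N * C j) = N * C j * A i + N * D j * M * (N * C i) \<and>
        N * C i * (B j * M) + N * D i * M * (N * D j * M) = N * C j * (B i * M) + N * D j * M * (N * D i * M)"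
      by (metis (no_types))
  }
  moreover have "A i \<in> carrier_mat n n \<and> B i * M \<in> carrier_mat n q \<and> N * C i \<in> carrier_mat q n \<and>
      N * D i * M \<in> carrier_mat q q" if i: "i \<in> S" for i
    using block_extensionD[OF ext i] M N by auto
  ultimately show ?thesis unfolding block_extension_def by blast
qed

text \<open>An extension is determined only up to conjugation, so it may have to be conjugated
  before it becomes fixed. Making \<open>B k\<close> fixed is enough, since \<open>k\<close> lies in
  every triple.\<close>

lemma (in subfield_projection) fixed_block_extension:
  assumes ext: "block_extension n q S A B C D"
    and k: "k \<in> S" and S: "S \<noteq> {k}"
    and full: "\<And>l. l \<in> S - {k} \<Longrightarrow> \<exists>m\<in>S - {k, l}. full_rank_triple n q A k l m"
    and fixA: "\<And>i. i \<in> S \<Longrightarrow> fixed (A i)"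
  shows "\<exists>B C D. block_extension n q S A B C D \<and> (\<forall>i\<in>S. fixed (B i) \<and> fixed (C i) \<and> fixed (D i))"
proof -
  \<comment> \<open>The triple \<open>T\<close> is chosen from \<open>A\<close> alone, so that it
    serves the given extension and its conjugate alike.\<close>
  have triple: "\<exists>T \<subseteq> S. {k, l} \<subseteq> T \<and> (\<forall>a\<in>T. \<forall>b\<in>T. \<exists>c\<in>T. c \<noteq> a \<and> c \<noteq> b) \<and>
      (\<forall>B C D. block_extension n q S A B C D \<longrightarrow> nondegenerate n q T B C)" if l: "l \<in> S - {k}" for l
  proof -
    obtain m where m: "m \<in> S - {k, l}" and f: "full_rank_triple n q A k l m" using full[OF l] by auto
    have dist: "k \<noteq> l" "k \<noteq> m" "l \<noteq> m" and lS: "l \<in> S" and mS: "m \<in> S" using l m by auto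
    have "{k, l, m} \<subseteq> S" using k lS mS by auto
    then show ?thesis
      using full_rank_triple_imp_nondegenerate[OF _ k lS mS dist f] triple_third[OF dist]
      by (intro exI[of _ "{k, l, m}"]) blast
  qed
  obtain l0 where l0: "l0 \<in> S - {k}" using k S by auto
  from triple[OF l0] obtain T where T: "T \<subseteq> S" "{k, l0} \<subseteq> T"
    "\<forall>a\<in>T. \<forall>b\<in>T. \<exists>c\<in>T. c \<noteq> a \<and> c \<noteq> b"
    "\<forall>B C D. block_extension n q S A B C D \<longrightarrow> nondegenerate n q T B C" by (elim exE conjE)
  have kT: "k \<in> T" using T(2) by simp
  have nd: "nondegenerate n q T B C" using T(4) ext by blast
  obtain M N where M: "M \<in> carrier_mat q q" and N: "N \<in> carrier_mat q q" and MN: "M * N = 1\<^sub>m q"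
    and fixBM: "fixed (B k * M)"
    using fixed_column_basis[OF ext nd T(1) T(3)[rule_format] fixA[OF subsetD[OF T(1)]] kT] by blast
  note ext' = block_extension_conj[OF ext M N MN]
  let ?B = "\<lambda>i. B i * M" and ?C = "\<lambda>i. N * C i" and ?D = "\<lambda>i. N * D i * M"
  have "fixed (?B i) \<and> fixed (?C i) \<and> fixed (?D i)" if i: "i \<in> S" for i
  proof -
    \<comment> \<open>The index \<open>k\<close> itself is covered by the triple of
      \<open>l0\<close>.\<close>
    define l where "l = (if i = k then l0 else i)"
    have "l \<in> S - {k}" using i l0 unfolding l_def by auto
    from triple[OF this] obtain T where TS: "T \<subseteq> S" and kl: "{k, l} \<subseteq> T"
      and third: "\<forall>a\<in>T. \<forall>b\<in>T. \<exists>c\<in>T. c \<noteq> a \<and> c \<noteq> b"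
      and nd: "\<forall>B C D. block_extension n q S A B C D \<longrightarrow> nondegenerate n q T B C" by (elim exE conjE)
    have kT: "k \<in> T" and iT: "i \<in> T" using kl unfolding l_def by (auto split: if_splits)
    have nd': "nondegenerate n q T ?B ?C" using nd ext' by metis
    note fix_T = fixed_on_triple[OF ext' nd' TS third[rule_format] fixA[OF subsetD[OF TS]] kT fixBM iT]
    from fix_T show ?thesis by simp
  qed
  then show ?thesis using ext' by blast
qed

text \<open>Through \<open>hom\<close> the large field is a vector space over the small one, and
  \<open>hom\<close> is an injective linear map; as such it has a linear left inverse.\<close>

lemma (in field_hom) retraction_exists:
  "\<exists>\<pi>. (\<forall>x y. \<pi> (x + y) = \<pi> x + \<pi> y) \<and> (\<forall>a x. \<pi> (hom a * x) = a * \<pi> x) \<and> (\<forall>a. \<pi> (hom a) = a)"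
proof -
  interpret vector_space_pair "(*) :: 'a \<Rightarrow> 'a \<Rightarrow> 'a" "\<lambda>a x. hom a * x"
    by unfold_locales (auto simp: algebra_simps hom_distribs)
  have "Vector_Spaces.linear (*) (\<lambda>a x. hom a * x) hom"
    by unfold_locales (auto simp: hom_distribs)
  moreover have "inj hom" by (rule injI) simp
  ultimately obtain \<pi> where lin: "Vector_Spaces.linear (\<lambda>a x. hom a * x) (*) \<pi>" and id: "\<pi> \<circ> hom = id"
    using linear_injective_left_inverse by blast
  interpret \<pi>: Vector_Spaces.linear "\<lambda>a x. hom a * x" "(*)" \<pi> by (rule lin)
  show ?thesis using \<pi>.add \<pi>.scale fun_cong[OF id] by (intro exI[of _ \<pi>]) simp
qed

section \<open>Transfer along a field homomorphism\<close>

context field_hom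
begin

lemma map_mat_hom_mult: "dim_col U = dim_row V \<Longrightarrow> map_mat hom (U * V) = map_mat hom U * map_mat hom V"
  by (rule mat_hom_mult) auto

lemma map_mat_hom_add:
  "dim_row U = dim_row V \<Longrightarrow> dim_col U = dim_col V \<Longrightarrow> map_mat hom (U + V) = map_mat hom U + map_mat hom V"
  by (intro eq_matI) (auto simp: hom_distribs)

lemma map_mat_hom_commutator:
  "U \<in> carrier_mat n n \<Longrightarrow> V \<in> carrier_mat n n \<Longrightarrow>
    map_mat hom (commutator U V) = commutator (map_mat hom U) (map_mat hom V)"
  unfolding commutator_def by (intro eq_matI) (auto simp: hom_distribs map_mat_hom_mult[symmetric])

lemma full_rank_triple_map_mat:
  assumes full: "full_rank_triple n q A k l m"
    and A: "A k \<in> carrier_mat n n" "A l \<in> carrier_mat n n" "A m \<in> carrier_mat n n"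
  shows "full_rank_triple n q (\<lambda>i. map_mat hom (A i)) k l m"
proof -
  have pair: "\<exists>L\<in>carrier_mat (2 * q) n. \<exists>E\<in>carrier_mat n (2 * q).
      L * (commutator (map_mat hom (A i)) (map_mat hom (A j)) * E) = 1\<^sub>m (2 * q)"
    if ij: "(i, j) \<in> {(k, l), (k, m), (l, m)}" for i j
  proof -
    have c: "A i \<in> carrier_mat n n" "A j \<in> carrier_mat n n" using ij A by auto
    then have com: "commutator (A i) (A j) \<in> carrier_mat n n" unfolding commutator_def by auto
    obtain L E where L: "L \<in> carrier_mat (2 * q) n" and E: "E \<in> carrier_mat n (2 * q)"
      and LE: "L * (commutator (A i) (A j) * E) = 1\<^sub>m (2 * q)"
      using full ij unfolding full_rank_triple_def by blast
    from arg_cong[OF LE, of "map_mat hom"]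
    have "map_mat hom L * (commutator (map_mat hom (A i)) (map_mat hom (A j)) * map_mat hom E) = 1\<^sub>m (2 * q)"
      using L E com c by (simp add: map_mat_hom_mult mat_hom_one map_mat_hom_commutator)
    then show ?thesis using L E map_carrier_mat by blast
  qed
  have com: "commutator (A k) (A l) \<in> carrier_mat n n" "commutator (A k) (A m) \<in> carrier_mat n n"
    using A unfolding commutator_def by auto
  obtain L E E' where L: "L \<in> carrier_mat (3 * q) n" and E: "E \<in> carrier_mat n (3 * q)"
    and E': "E' \<in> carrier_mat n (3 * q)"
    and LE: "L * (commutator (A k) (A l) * E + commutator (A k) (A m) * E') = 1\<^sub>m (3 * q)"
    using full unfolding full_rank_triple_def by blast
  from arg_cong[OF LE, of "map_mat hom"]
  have "map_mat hom L * (commutator (map_mat hom (A k)) (map_mat hom (A l)) * map_mat hom E +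
      commutator (map_mat hom (A k)) (map_mat hom (A m)) * map_mat hom E') = 1\<^sub>m (3 * q)"
    using L E E' com A by (simp add: map_mat_hom_mult map_mat_hom_add mat_hom_one map_mat_hom_commutator)
  then have "\<exists>L\<in>carrier_mat (3 * q) n. \<exists>E\<in>carrier_mat n (3 * q). \<exists>E'\<in>carrier_mat n (3 * q).
      L * (commutator (map_mat hom (A k)) (map_mat hom (A l)) * E +
        commutator (map_mat hom (A k)) (map_mat hom (A m)) * E') = 1\<^sub>m (3 * q)"
    using L E E' map_carrier_mat by blast
  then show ?thesis using pair unfolding full_rank_triple_def by blast
qed

text \<open>The composite of \<open>hom\<close> and a retraction \<open>\<pi>\<close> projects the
  large field onto the image of \<open>hom\<close>. Fixed blocks are images under
  \<open>hom\<close>, and \<open>\<pi>\<close> recovers their preimages.\<close>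

lemma block_extension_descends:
  assumes ext: "block_extension n q S (\<lambda>i. map_mat hom (A i)) B C D"
    and k: "k \<in> S" and S: "S \<noteq> {k}"
    and full: "\<And>l. l \<in> S - {k} \<Longrightarrow> \<exists>m\<in>S - {k, l}. full_rank_triple n q A k l m"
  shows "\<exists>B C D. block_extension n q S A B C D"
proof -
  have A: "A i \<in> carrier_mat n n" if "i \<in> S" for i
    using block_extensionD(1)[OF ext that] by simp
  obtain \<pi> where \<pi>: "\<And>x y. \<pi> (x + y) = \<pi> x + \<pi> y" "\<And>a x. \<pi> (hom a * x) = a * \<pi> x" "\<And>a. \<pi> (hom a) = a"
    using retraction_exists by blast
  interpret p: subfield_projection "\<lambda>x. hom (\<pi> x)"
    using \<pi>(3)[of 1] by unfold_locales (auto simp: \<pi> hom_distribs)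
  have fixA: "p.fixed (map_mat hom (A i))" for i
    unfolding p.fixed_def by (intro eq_matI) (auto simp: \<pi>)
  have full': "\<exists>m\<in>S - {k, l}. full_rank_triple n q (\<lambda>i. map_mat hom (A i)) k l m"
    if l: "l \<in> S - {k}" for l
  proof -
    obtain m where m: "m \<in> S - {k, l}" "full_rank_triple n q A k l m" using full[OF l] by blast
    then show ?thesis using full_rank_triple_map_mat[OF m(2)] A k l by blast
  qed
  from p.fixed_block_extension[OF ext k S full' fixA] obtain B C D where
    ext': "block_extension n q S (\<lambda>i. map_mat hom (A i)) B C D"
    and fixed: "\<And>i. i \<in> S \<Longrightarrow> p.fixed (B i)" "\<And>i. i \<in> S \<Longrightarrow> p.fixed (C i)" "\<And>i. i \<in> S \<Longrightarrow> p.fixed (D i)"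
    by blast
  have lift: "map_mat hom (map_mat \<pi> U) = U" if "p.fixed U" for U
    using that unfolding p.fixed_def by (metis (no_types, lifting) eq_matI index_map_mat)
  let ?B = "\<lambda>i. map_mat \<pi> (B i)" and ?C = "\<lambda>i. map_mat \<pi> (C i)" and ?D = "\<lambda>i. map_mat \<pi> (D i)"
  have c: "?B i \<in> carrier_mat n q" "?C i \<in> carrier_mat q n" "?D i \<in> carrier_mat q q" if "i \<in> S" for i
    using block_extensionD[OF ext' that] by auto
  have "A i * A j + ?B i * ?C j = A j * A i + ?B j * ?C i \<and>
        A i * ?B j + ?B i * ?D j = A j * ?B i + ?B j * ?D i \<and>
        ?C i * A j + ?D i * ?C j = ?C j * A i + ?D j * ?C i \<and>
        ?C i * ?B j + ?D i * ?D j = ?C j * ?B i + ?D j * ?D i" if i: "i \<in> S" and j: "j \<in> S" for i j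
  proof -
    note cij = c[OF i] c[OF j] A[OF i] A[OF j]
    note l = lift[OF fixed(1)[OF i]] lift[OF fixed(2)[OF i]] lift[OF fixed(3)[OF i]]
      lift[OF fixed(1)[OF j]] lift[OF fixed(2)[OF j]] lift[OF fixed(3)[OF j]]
    note eqs = ext'[unfolded block_extension_def, THEN conjunct2, rule_format, OF i j]
    note d = carrier_matD[OF cij(1)] carrier_matD[OF cij(2)] carrier_matD[OF cij(3)] carrier_matD[OF cij(4)]
      carrier_matD[OF cij(5)] carrier_matD[OF cij(6)] carrier_matD[OF cij(7)] carrier_matD[OF cij(8)]
    \<comment> \<open>The relations are verified after applying \<open>hom\<close>, where they are
      those of the fixed extension, and pulled back by injectivity.\<close>
    have "map_mat hom (A i * A j + ?B i * ?C j) = map_mat hom (A j * A i + ?B j * ?C i)"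
      "map_mat hom (A i * ?B j + ?B i * ?D j) = map_mat hom (A j * ?B i + ?B j * ?D i)"
      "map_mat hom (?C i * A j + ?D i * ?C j) = map_mat hom (?C j * A i + ?D j * ?C i)"
      "map_mat hom (?C i * ?B j + ?D i * ?D j) = map_mat hom (?C j * ?B i + ?D j * ?D i)"
      using eqs d by (simp_all add: map_mat_hom_mult map_mat_hom_add l)
    then show ?thesis by (auto dest: mat_hom_inj)
  qed
  then have "block_extension n q S A ?B ?C ?D"
    unfolding block_extension_def using c A by blast
  then show ?thesis by blast
qed

end

subsection \<open>Commuting extensions as block matrices\<close>

lemma four_block_mat_inject:
  assumes "A \<in> carrier_mat n n" "B \<in> carrier_mat n q" "C \<in> carrier_mat q n" "D \<in> carrier_mat q q"
    and "A' \<in> carrier_mat n n" "B' \<in> carrier_mat n q" "C' \<in> carrier_mat q n" "D' \<in> carrier_mat q q"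
    and eq: "four_block_mat A B C D = four_block_mat A' B' C' D'"
  shows "A = A'" "B = B'" "C = C'" "D = D'"
proof -
  have e: "four_block_mat A B C D $$ (i, j) = four_block_mat A' B' C' D' $$ (i, j)" for i j
    using eq by simp
  show "A = A'"
  proof (intro eq_matI)
    fix i j assume "i < dim_row A'" "j < dim_col A'"
    then show "A $$ (i, j) = A' $$ (i, j)" using e[of i j] assms(1-8) by simp
  qed (use assms(1-8) in auto)
  show "B = B'"
  proof (intro eq_matI)
    fix i j assume "i < dim_row B'" "j < dim_col B'"
    then show "B $$ (i, j) = B' $$ (i, j)" using e[of i "n + j"] assms(1-8) by simp
  qed (use assms(1-8) in auto)
  show "C = C'"
  proof (intro eq_matI)
    fix i j assume "i < dim_row C'" "j < dim_col C'"
    then show "C $$ (i, j) = C' $$ (i, j)" using e[of "n + i" j] assms(1-8) by simp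
  qed (use assms(1-8) in auto)
  show "D = D'"
  proof (intro eq_matI)
    fix i j assume "i < dim_row D'" "j < dim_col D'"
    then show "D $$ (i, j) = D' $$ (i, j)" using e[of "n + i" "n + j"] assms(1-8) by simp
  qed (use assms(1-8) in auto)
qed

lemma commuting_extension_imp_block_extension:
  assumes A: "\<forall>i\<in>{1..p}. A i \<in> carrier_mat n n" and ext: "commuting_extension n r p A Z"
  obtains B C D where "block_extension n (r - n) {1..p} A B C D"
    and "\<And>i. i \<in> {1..p} \<Longrightarrow> Z i = four_block_mat (A i) (B i) (C i) (D i)"
proof -
  let ?q = "r - n"
  have "\<forall>i\<in>{1..p}. \<exists>B C D. B \<in> carrier_mat n ?q \<and> C \<in> carrier_mat ?q n \<and> D \<in> carrier_mat ?q ?q \<and>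
      Z i = four_block_mat (A i) B C D"
    using ext unfolding commuting_extension_def by blast
  then obtain B C D where c: "\<And>i. i \<in> {1..p} \<Longrightarrow> B i \<in> carrier_mat n ?q" "\<And>i. i \<in> {1..p} \<Longrightarrow> C i \<in> carrier_mat ?q n"
    "\<And>i. i \<in> {1..p} \<Longrightarrow> D i \<in> carrier_mat ?q ?q"
    and Z: "\<And>i. i \<in> {1..p} \<Longrightarrow> Z i = four_block_mat (A i) (B i) (C i) (D i)"
    by metis
  have "A i * A j + B i * C j = A j * A i + B j * C i \<and>
        A i * B j + B i * D j = A j * B i + B j * D i \<and>
        C i * A j + D i * C j = C j * A i + D j * C i \<and>
        C i * B j + D i * D j = C j * B i + D j * D i" if i: "i \<in> {1..p}" and j: "j \<in> {1..p}" for i j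
  proof -
    note ci = bspec[OF A i] c[OF i] and cj = bspec[OF A j] c[OF j]
    have "Z i * Z j = Z j * Z i" using ext i j unfolding commuting_extension_def by blast
    then have eq: "four_block_mat (A i * A j + B i * C j) (A i * B j + B i * D j)
        (C i * A j + D i * C j) (C i * B j + D i * D j) =
      four_block_mat (A j * A i + B j * C i) (A j * B i + B j * D i)
        (C j * A i + D j * C i) (C j * B i + D j * D i)"
      unfolding Z[OF i] Z[OF j] mult_four_block_mat[OF ci cj] mult_four_block_mat[OF cj ci] .
    note car = add_carrier_mat[OF mult_carrier_mat[OF ci(2) cj(3)]]
      add_carrier_mat[OF mult_carrier_mat[OF ci(2) cj(4)]]
      add_carrier_mat[OF mult_carrier_mat[OF ci(4) cj(3)]]
      add_carrier_mat[OF mult_carrier_mat[OF ci(4) cj(4)]]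
      add_carrier_mat[OF mult_carrier_mat[OF cj(2) ci(3)]]
      add_carrier_mat[OF mult_carrier_mat[OF cj(2) ci(4)]]
      add_carrier_mat[OF mult_carrier_mat[OF cj(4) ci(3)]]
      add_carrier_mat[OF mult_carrier_mat[OF cj(4) ci(4)]]
    show ?thesis using four_block_mat_inject[OF car eq] by blast
  qed
  then have "block_extension n ?q {1..p} A B C D" unfolding block_extension_def using A c by blast
  then show thesis using that Z by blast
qed

lemma block_extension_imp_commuting_extension:
  assumes "n \<le> r" and ext: "block_extension n (r - n) {1..p} A B C D"
  shows "commuting_extension n r p A (\<lambda>i. four_block_mat (A i) (B i) (C i) (D i))"
proof -
  note c = block_extensionD[OF ext]
  have "four_block_mat (A i) (B i) (C i) (D i) \<in> carrier_mat r r" if i: "i \<in> {1..p}" for i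
    using four_block_carrier_mat[OF c(1,4)[OF i]] assms(1) by simp
  moreover have "four_block_mat (A i) (B i) (C i) (D i) * four_block_mat (A j) (B j) (C j) (D j) =
      four_block_mat (A j) (B j) (C j) (D j) * four_block_mat (A i) (B i) (C i) (D i)"
    if i: "i \<in> {1..p}" and j: "j \<in> {1..p}" for i j
    unfolding mult_four_block_mat[OF c[OF i] c[OF j]] mult_four_block_mat[OF c[OF j] c[OF i]]
    using ext i j unfolding block_extension_def by simp
  ultimately show ?thesis unfolding commuting_extension_def using c by blast
qed

lemma rho_four_block_mat:
  fixes M :: "'a :: field mat"
  assumes nr: "n \<le> r" and M: "M \<in> carrier_mat (r - n) (r - n)" and N: "N \<in> carrier_mat (r - n) (r - n)"
    and MN: "M * N = 1\<^sub>m (r - n)" and NM: "N * M = 1\<^sub>m (r - n)"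
    and A: "A \<in> carrier_mat n n" and B: "B \<in> carrier_mat n (r - n)"
    and C: "C \<in> carrier_mat (r - n) n" and D: "D \<in> carrier_mat (r - n) (r - n)"
  shows "rho n r M (four_block_mat A B C D) = four_block_mat A (B * M) (N * C) (N * D * M)"
proof -
  let ?q = "r - n"
  interpret ring "ring_mat TYPE('a) r ()" by (rule ring_mat)
  \<comment> \<open>\<open>G U\<close> is block diagonal with blocks 1 and \<open>U\<close> and is
    multiplicative in \<open>U\<close>; hence the inverse of \<open>G M\<close> is
    \<open>G N\<close>.\<close>
  define G where "G U = four_block_mat (1\<^sub>m n) (0\<^sub>m n ?q) (0\<^sub>m ?q n) U" for U :: "'a mat"
  have one: "1\<^sub>m n \<in> carrier_mat n n" and z: "0\<^sub>m n ?q \<in> carrier_mat n ?q" "0\<^sub>m ?q n \<in> carrier_mat ?q n" by auto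
  have G: "G U \<in> carrier_mat r r" if "U \<in> carrier_mat ?q ?q" for U
    unfolding G_def using four_block_carrier_mat[OF one that] nr by simp
  have GG: "G U * G V = G (U * V)" if "U \<in> carrier_mat ?q ?q" "V \<in> carrier_mat ?q ?q" for U V
    unfolding G_def mult_four_block_mat[OF one z that(1) one z that(2)] using that by simp
  have G1: "G (1\<^sub>m ?q) = 1\<^sub>m r" unfolding G_def four_block_one_mat using nr by simp
  have "inv\<^bsub>ring_mat TYPE('a) r ()\<^esub> (G M) = G N"
    using GG[OF M N] GG[OF N M] G[OF M] G[OF N] MN NM G1
    by (intro inv_char) (auto simp: ring_mat_simps)
  then have "rho n r M (four_block_mat A B C D) = G N * four_block_mat A B C D * G M"
    unfolding rho_def Let_def G_def by simp
  also have "G N * four_block_mat A B C D = four_block_mat A B (N * C) (N * D)"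
    unfolding G_def mult_four_block_mat[OF one z N A B C D] using A B C D N by simp
  also have "\<dots> * G M = four_block_mat A (B * M) (N * C) (N * D * M)"
  proof -
    have NC: "N * C \<in> carrier_mat ?q n" "N * D \<in> carrier_mat ?q ?q" using N C D by auto
    show ?thesis unfolding G_def mult_four_block_mat[OF A B NC one z M] using A B C D N M by simp
  qed
  finally show ?thesis .
qed

theorem theorem3:
  fixes A :: "nat \<Rightarrow> 'a::field mat" and n r p :: nat
  assumes "n \<le> r" and "p \<ge> 3"
    and "\<forall>i\<in>{1..p}. A i \<in> carrier_mat n n"
    and "\<forall>l\<in>{2..p}. \<exists>m\<in>{1..p} - {1, l}. hypothesis_H n r A 1 l m"
  shows "((\<exists>Z. commuting_extension n r p A Z) \<longrightarrow> essentially_unique_extension n r p A) \<and>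
         ((\<exists>Z :: nat \<Rightarrow> 'a alg_closure mat.
             commuting_extension n r p (\<lambda>i. map_mat to_ac (A i)) Z) \<longrightarrow>
          (\<exists>Z :: nat \<Rightarrow> 'a mat. commuting_extension n r p A Z))"
proof -
  let ?S = "{1..p}" and ?q = "r - n"
  note A = assms(3)
  have k: "1 \<in> ?S" and "2 \<in> ?S" using assms(2) by auto
  \<comment> \<open>The index 2 differs from 1, so there is at least one triple to start
    from.\<close>
  then have S: "?S \<noteq> {1}" by (metis numeral_eq_one_iff semiring_norm(85) singletonD)
  have full: "\<exists>m\<in>?S - {1, l}. full_rank_triple n ?q A 1 l m" if l: "l \<in> ?S - {1}" for l
  proof -
    have "l \<in> {2..p}" using l by auto
    then obtain m where m: "m \<in> ?S - {1, l}" and H: "hypothesis_H n r A 1 l m" using assms(4) by blast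
    have "full_rank_triple n ?q A 1 l m"
      using hypothesis_H_imp_full_rank_triple[OF H] A k l m by blast
    then show ?thesis using m by blast
  qed
  have "essentially_unique_extension n r p A"
    unfolding essentially_unique_extension_def
  proof (intro allI impI)
    fix Z Z' assume Z: "commuting_extension n r p A Z" and Z': "commuting_extension n r p A Z'"
    obtain B C D where ext: "block_extension n ?q ?S A B C D"
      and Zi: "\<And>i. i \<in> ?S \<Longrightarrow> Z i = four_block_mat (A i) (B i) (C i) (D i)"
      using commuting_extension_imp_block_extension[OF A Z] by blast
    obtain B' C' D' where ext': "block_extension n ?q ?S A B' C' D'"
      and Zi': "\<And>i. i \<in> ?S \<Longrightarrow> Z' i = four_block_mat (A i) (B' i) (C' i) (D' i)"
      using commuting_extension_imp_block_extension[OF A Z'] by blast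
    from block_extension_unique[OF ext ext' k S full] obtain M N where
      M: "M \<in> carrier_mat ?q ?q" and N: "N \<in> carrier_mat ?q ?q" and MN: "M * N = 1\<^sub>m ?q" and NM: "N * M = 1\<^sub>m ?q"
      and eq: "\<And>i. i \<in> ?S \<Longrightarrow> B' i = B i * M" "\<And>i. i \<in> ?S \<Longrightarrow> C' i = N * C i"
        "\<And>i. i \<in> ?S \<Longrightarrow> D' i = N * D i * M" by blast
    have "M \<in> GL ?q" unfolding GL_def Units_def using M N MN NM by (auto simp: ring_mat_simps)
    moreover have "Z' i = rho n r M (Z i)" if i: "i \<in> ?S" for i
      unfolding Zi[OF i] Zi'[OF i] eq[OF i]
      using rho_four_block_mat[OF assms(1) M N MN NM block_extensionD[OF ext i]] by simp
    ultimately show "\<exists>M\<in>GL ?q. \<forall>i\<in>?S. Z' i = rho n r M (Z i)" by blast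
  qed
  moreover have "\<exists>Z. commuting_extension n r p A Z"
    if Z: "commuting_extension n r p (\<lambda>i. map_mat to_ac (A i)) Z" for Z :: "nat \<Rightarrow> 'a alg_closure mat"
  proof -
    \<comment> \<open>The descent along an arbitrary field homomorphism is applied to the embedding
      into the algebraic closure.\<close>
    interpret field_hom "to_ac :: 'a \<Rightarrow> 'a alg_closure" by unfold_locales auto
    have A': "\<forall>i\<in>?S. map_mat to_ac (A i) \<in> carrier_mat n n" using A by simp
    obtain B C D where ext: "block_extension n ?q ?S (\<lambda>i. map_mat to_ac (A i)) B C D"
      by (rule commuting_extension_imp_block_extension[OF A' Z])
    from block_extension_descends[OF ext k S full] obtain B C D where "block_extension n ?q ?S A B C D"
      by blast
    then show ?thesis using block_extension_imp_commuting_extension[OF assms(1)] by blast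
  qed
  ultimately show ?thesis by blast
qed

end
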